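(* Let $T$ be a quadratic starlike tree containing $K_{1,3}$ as a proper induced subgraph. Then its characteristic polynomial has one of the two forms (I) $f_T(x)=x^{t_1}(x^2-1)^{t_2}(x^2-2)^{t_3}((x^2-x-1)(x^2+x-1))^{t_4}(x^2-3)^{t_5}(x^2-c)$, where $c\ge 4$ and $t_1,\dots,t_5\ge0$ are integers and $\lambda_1(T)$ is a root of $x^2-c$; or (II) $f_T(x)=x^{t_1}(x^2-1)^{t_2}(x^2-2)^{t_3}((x^2-x-1)(x^2+x-1))^{t_4}(x^2-3)^{t_5}(x^2-ax+b)(x^2+ax+b)$, where $a>0$, $b$, $t_1,\dots,t_5\ge0$ are integers, $\Delta=a^2-4b>0$ is a square-free number, and $\lambda_1(T)$ is a root of $x^2-ax+b$.
   Context: Eigenvalues are those of the adjacency matrix, $\lambda_1(T)$ the largest, $f_T(x)=\det(xI-A(T))$. A graph is quadratic if every irreducible factor over $\mathbb{Q}$ of its characteristic polynomial has degree at most $2$. A starlike tree is a tree with a center vertex $u$ such that $T-u$ is a disjoint union of paths, each joined by an edge from one endpoint to $u$. In this paper "square-free number" is used to mean a positive integer that is not a perfect square (so that $x^2\pm ax+b$ is irreducible over $\mathbb{Q}$). *)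

theory Defs
  imports
    "Graph_Theory.Graph_Theory"
    "Jordan_Normal_Form.Char_Poly"
    "HOL-Computational_Algebra.Polynomial_Factorial"
    "HOL-Computational_Algebra.Nth_Powers"
begin

text \<open>
  A finite simple graph is a symmetric digraph without loops and multiple arcs, i.e. the locale
  predicate \<^term>\<open>graph\<close>; adjacency of two vertices is \<^term>\<open>dominates\<close>.
\<close>

text \<open>
  The library's \<^const>\<open>Digraph_Component.tree\<close> is meant for directed graphs: in a symmetric digraph
  every edge already yields a directed cycle of length 2, so it would leave only the one-vertex
  graph. The cycles of an undirected simple graph are the directed cycles of length at least 3.
\<close>

definition undirected_tree :: "('a, 'b) pre_digraph \<Rightarrow> bool" where
  "undirected_tree G \<longleftrightarrow> graph G \<and> Digraph_Component.connected G \<and>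
     \<not> (\<exists>p. pre_digraph.cycle G p \<and> 3 \<le> length p)"

definition path_ends :: "'a list \<Rightarrow> ('a \<times> 'a) set" where
  "path_ends p = set (zip p (tl p)) \<union> (set (zip p (tl p)))\<inverse>"

text \<open>
  The lists in \<open>ps\<close> are the vertex sequences of the paths that make up \<open>G\<close> minus \<open>u\<close>, each listed
  from the endpoint that is joined to \<open>u\<close>. Disjointness of the paths and of the vertices within a
  path is expressed by distinctness of the concatenation.
\<close>

definition starlike_center :: "('a, 'b) pre_digraph \<Rightarrow> 'a \<Rightarrow> bool" where
  "starlike_center G u \<longleftrightarrow> u \<in> verts G \<and>
     (\<exists>ps. [] \<notin> set ps \<and> distinct (concat ps) \<and>
        verts (pre_digraph.del_vert G u) = set (concat ps) \<and>
        arcs_ends (pre_digraph.del_vert G u) = (\<Union>p\<in>set ps. path_ends p) \<and>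
        {v. u \<rightarrow>\<^bsub>G\<^esub> v} = hd ` set ps)"

definition starlike_tree :: "('a, 'b) pre_digraph \<Rightarrow> bool" where
  "starlike_tree G \<longleftrightarrow> undirected_tree G \<and> (\<exists>u. starlike_center G u)"

definition has_proper_induced_K13 :: "('a, 'b) pre_digraph \<Rightarrow> bool" where
  "has_proper_induced_K13 G \<longleftrightarrow> (\<exists>H. induced_subgraph H G \<and> H \<noteq> G \<and> K\<^bsub>1,3\<^esub> H)"

text \<open>
  The vertices are enumerated in an arbitrary order; a different order conjugates the adjacency
  matrix by a permutation matrix, which affects neither its characteristic polynomial nor its
  eigenvalues.
\<close>

definition vertex_list :: "('a, 'b) pre_digraph \<Rightarrow> 'a list" where
  "vertex_list G = (SOME vs. distinct vs \<and> set vs = verts G)"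

definition adjacency_matrix :: "('a, 'b) pre_digraph \<Rightarrow> 'c :: zero_neq_one mat" where
  "adjacency_matrix G = (let vs = vertex_list G; n = length vs in
     Matrix.mat n n (\<lambda>(i, j). if (vs ! i) \<rightarrow>\<^bsub>G\<^esub> (vs ! j) then 1 else 0))"

definition graph_char_poly :: "('a, 'b) pre_digraph \<Rightarrow> rat poly" where
  "graph_char_poly G = char_poly (adjacency_matrix G)"

definition quadratic_graph :: "('a, 'b) pre_digraph \<Rightarrow> bool" where
  "quadratic_graph G \<longleftrightarrow> graph G \<and>
     (\<forall>p. Factorial_Ring.irreducible p \<and> p dvd graph_char_poly G \<longrightarrow> degree p \<le> 2)"

definition largest_eigenvalue :: "('a, 'b) pre_digraph \<Rightarrow> real" where
  "largest_eigenvalue G = Max {k. eigenvalue (adjacency_matrix G :: real mat) k}"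

end

theory Submission
  imports Defs "Berlekamp_Zassenhaus.Factor_Bound"
begin

text \<open>
  Removing leaves one at a time expresses the characteristic polynomial of a starlike tree with
  branch lengths \<open>n\<^sub>1, \<dots>, n\<^sub>k\<close> as \<open>(\<Prod>i. P n\<^sub>i) * (x - (\<Sum>i. P (n\<^sub>i - 1) / P n\<^sub>i))\<close>, where \<open>P n\<close> is
  the characteristic polynomial of the path on \<open>n\<close> vertices.
  On \<open>[2, \<infinity>)\<close> the first factor is at least 1 and the second one grows at least as fast as \<open>x\<close>, so
  there is at most one eigenvalue \<open>\<ge> 2\<close>, and it is simple; on the upper half plane the second factor
  has positive imaginary part, so all eigenvalues are real. By symmetry of the spectrum, every
  irreducible factor of degree at most 2 that has neither \<open>\<lambda>\<^sub>1\<close> nor \<open>-\<lambda>\<^sub>1\<close> as a root has all its roots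
  in \<open>(-2, 2)\<close>, which leaves only the finitely many elementary factors. Their roots are at most
  \<open>sqrt 3\<close>, whereas a starlike tree properly containing the claw has an eigenvalue above \<open>sqrt 3\<close>:
  with \<open>N\<close> the largest branch length, the characteristic polynomial is negative at \<open>sqrt 3\<close> or at the
  largest root \<open>2 * cos (pi / (N + 2))\<close> of \<open>P (N + 1)\<close>. So \<open>\<lambda>\<^sub>1 \<ge> 2\<close>, and the minimal polynomial of
  \<open>\<lambda>\<^sub>1\<close> together with its reflection supplies the remaining factor.
\<close>

hide_const (open) module.smult Divisibility.irreducible up_ring.monom up_ring.coeff

subsection \<open>Values of the characteristic polynomials of paths and starlike trees\<close>

text \<open>The recursions make sense in any commutative ring: at \<open>[:0, 1:]\<close> they give the polynomials
  themselves, at a number their values.\<close>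

fun path_val :: "nat \<Rightarrow> 'a::comm_ring_1 \<Rightarrow> 'a" where
  "path_val 0 x = 1"
| "path_val (Suc 0) x = x"
| "path_val (Suc (Suc n)) x = x * path_val (Suc n) x - path_val n x"

text \<open>The predecessor of \<open>path_val n\<close> in the recursion, continued to index -1 by
  the value 0; truncated subtraction would give 1 at \<open>n = 0\<close>.\<close>

fun path_val_pred :: "nat \<Rightarrow> 'a::comm_ring_1 \<Rightarrow> 'a" where
  "path_val_pred 0 x = 0"
| "path_val_pred (Suc n) x = path_val n x"

definition forest_val :: "nat list \<Rightarrow> 'a::comm_ring_1 \<Rightarrow> 'a" where
  "forest_val ns x = (\<Prod>n\<leftarrow>ns. path_val n x)"

text \<open>The bridge formula f(G) = f(G - e) - f(G - u - v) for the edge e from the center u to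
  the end v of a branch. Without u only paths remain, hence the factor
  \<open>forest_val ns\<close>.\<close>

fun star_val :: "nat list \<Rightarrow> 'a::comm_ring_1 \<Rightarrow> 'a" where
  "star_val [] x = x"
| "star_val (n # ns) x = path_val n x * star_val ns x - path_val_pred n x * forest_val ns x"

lemma forest_val_simps [simp]:
  "forest_val [] x = 1" "forest_val (n # ns) x = path_val n x * forest_val ns x"
  by (simp_all add: forest_val_def)

lemma path_val_Suc: "path_val (Suc n) x = x * path_val n x - path_val_pred n x"
  by (cases n) auto

lemma path_val_pred_Suc_Suc:
  "path_val_pred (Suc (Suc n)) x = x * path_val_pred (Suc n) x - path_val_pred n x"
  by (simp add: path_val_Suc)

lemma (in comm_ring_hom) hom_path_val: "hom (path_val n x) = path_val n (hom x)"
  by (induction n x rule: path_val.induct) (simp_all add: hom_distribs)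

lemma (in comm_ring_hom) hom_path_val_pred: "hom (path_val_pred n x) = path_val_pred n (hom x)"
  by (cases n) (simp_all add: hom_path_val)

lemma (in comm_ring_hom) hom_forest_val: "hom (forest_val ns x) = forest_val ns (hom x)"
  by (induction ns) (simp_all add: hom_distribs hom_path_val)

lemma (in comm_ring_hom) hom_star_val: "hom (star_val ns x) = star_val ns (hom x)"
  by (induction ns) (simp_all add: hom_distribs hom_path_val hom_path_val_pred hom_forest_val)

lemma poly_star_val: "poly (star_val ns p) x = star_val ns (poly p x)"
  by (rule poly_hom.hom_star_val)

lemma path_val_minus: "path_val n (-x) = (-1)^n * path_val n x"
  by (induction n x rule: path_val.induct) (simp_all add: algebra_simps)

lemma path_val_pred_minus: "path_val_pred n (-x) = - ((-1)^n * path_val_pred n x)"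
  by (cases n) (simp_all add: path_val_minus)

lemma forest_val_minus: "forest_val ns (-x) = (-1)^(sum_list ns) * forest_val ns x"
  by (induction ns) (simp_all add: path_val_minus power_add algebra_simps)

lemma star_val_minus: "star_val ns (-x) = - ((-1)^(sum_list ns) * star_val ns x)"
  by (induction ns)
    (simp_all add: path_val_minus path_val_pred_minus forest_val_minus power_add algebra_simps)

text \<open>The quotient turns the three-term recursion into a continued fraction, so that signs and
  monotonicity can be followed by a one-step induction.\<close>

definition branch :: "nat \<Rightarrow> 'a::field \<Rightarrow> 'a" where
  "branch n x = path_val_pred n x / path_val n x"

lemma branch_0 [simp]: "branch 0 x = 0"
  by (simp add: branch_def)

lemma branch_Suc: "path_val n x \<noteq> 0 \<Longrightarrow> branch (Suc n) x = 1 / (x - branch n x)"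
  by (simp add: branch_def path_val_Suc field_simps)

lemma path_val_Suc_branch: "path_val n x \<noteq> 0 \<Longrightarrow> path_val (Suc n) x = path_val n x * (x - branch n x)"
  by (simp add: branch_def path_val_Suc field_simps)

text \<open>Dividing the recursion by all path values makes the contributions of the branches
  additive, so each can be estimated on its own.\<close>

lemma star_val_branch:
  "(\<And>n. n \<in> set ns \<Longrightarrow> path_val n x \<noteq> 0) \<Longrightarrow>
    star_val ns x = forest_val ns x * (x - (\<Sum>n\<leftarrow>ns. branch n x))"
proof (induction ns)
  case (Cons n ns)
  then have "path_val_pred n x = path_val n x * branch n x" by (simp add: branch_def)
  moreover have "star_val ns x = forest_val ns x * (x - (\<Sum>n\<leftarrow>ns. branch n x))"
    using Cons by simp
  ultimately show ?case by (simp add: right_diff_distrib distrib_left mult_ac)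
qed simp

lemma forest_val_nonzero:
  fixes x :: "'a::field"
  shows "(\<And>n. n \<in> set ns \<Longrightarrow> path_val n x \<noteq> 0) \<Longrightarrow> forest_val ns x \<noteq> 0"
  by (induction ns) auto

subsection \<open>Real-rootedness\<close>

text \<open>If \<open>branch n z\<close> is not above the real axis, then
  \<open>z - branch n z\<close> is strictly above it, hence nonzero, and taking the reciprocal moves
  it below.\<close>

lemma path_val_upper_half_plane:
  fixes z :: complex
  assumes "Im z > 0"
  shows "path_val n z \<noteq> 0 \<and> Im (branch n z) \<le> 0"
proof (induction n)
  case (Suc n)
  then have *: "Im (z - branch n z) > 0" using assms by simp
  then have "z - branch n z \<noteq> 0" by force
  then have "path_val (Suc n) z \<noteq> 0" using Suc by (simp add: path_val_Suc_branch)
  moreover have "Im (branch (Suc n) z) \<le> 0"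
    using Suc * by (auto simp: branch_Suc Im_divide intro!: divide_nonpos_nonneg)
  ultimately show ?case by blast
qed simp

lemma star_val_real_rooted:
  fixes z :: complex
  assumes "star_val ns z = 0"
  shows "Im z = 0"
proof -
  have upper: "star_val ns z \<noteq> 0" if "Im z > 0" for z :: complex
  proof -
    have P: "path_val n z \<noteq> 0" and B: "Im (branch n z) \<le> 0" for n
      using path_val_upper_half_plane[OF that] by auto
    have "Im (\<Sum>n\<leftarrow>ns. branch n z) \<le> 0" by (induction ns) (use B in \<open>auto intro: add_nonpos_nonpos\<close>)
    then have "Im (z - (\<Sum>n\<leftarrow>ns. branch n z)) > 0" using that by simp
    then have "z - (\<Sum>n\<leftarrow>ns. branch n z) \<noteq> 0" by force
    then show ?thesis using P by (simp add: star_val_branch forest_val_nonzero)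
  qed
  \<comment> \<open>A root in the lower half plane would reflect to one in the upper half
    plane.\<close>
  have "star_val ns (-z) = 0" using assms by (simp add: star_val_minus)
  then show ?thesis using upper[of z] upper[of "-z"] assms by fastforce
qed

subsection \<open>Roots at least two\<close>

text \<open>The interval [0, 1) is invariant: \<open>x - branch n x\<close> exceeds 1, so its
  reciprocal is below 1, and multiplying by it keeps the path values at least 1.\<close>

lemma branch_ge_2:
  fixes x :: real
  assumes "x \<ge> 2"
  shows "path_val n x \<ge> 1 \<and> 0 \<le> branch n x \<and> branch n x < 1"
proof (induction n)
  case (Suc n)
  then have *: "x - branch n x > 1" using assms by simp
  then have "path_val n x * (x - branch n x) \<ge> 1 * 1" using Suc by (intro mult_mono) auto
  then have "path_val (Suc n) x \<ge> 1" using Suc by (simp add: path_val_Suc_branch)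
  then show ?case using Suc * by (simp add: branch_Suc)
qed simp

lemma branch_antimono:
  fixes x y :: real
  assumes "2 \<le> y" "y \<le> x"
  shows "branch n x \<le> branch n y"
proof (induction n)
  case (Suc n)
  have "path_val n x \<noteq> 0" "path_val n y \<noteq> 0" "branch n y < 1"
    using branch_ge_2[of x n] branch_ge_2[of y n] assms by auto
  then show ?case using Suc assms by (simp add: branch_Suc frac_le)
qed simp

lemma forest_val_ge_1:
  fixes x :: real
  assumes "x \<ge> 2"
  shows "forest_val ns x \<ge> 1"
proof (induction ns)
  case (Cons n ns)
  have "path_val n x * forest_val ns x \<ge> 1 * 1"
    using branch_ge_2[OF assms, of n] Cons by (intro mult_mono) auto
  then show ?case by simp
qed simp

lemma star_val_ge_2:
  fixes x :: real
  assumes "x \<ge> 2"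
  shows "star_val ns x = forest_val ns x * (x - (\<Sum>n\<leftarrow>ns. branch n x))"
proof (rule star_val_branch)
  show "path_val n x \<noteq> 0" for n using branch_ge_2[OF assms, of n] by auto
qed

text \<open>At \<open>y\<close> the second factor of the branch form vanishes, the first being at
  least 1. To the right the branch terms do not increase, so the second factor gains at least
  \<open>x - y\<close>. This bound yields both uniqueness and simplicity of a root that is at least
  2.\<close>

lemma star_val_growth:
  fixes x y :: real
  assumes "2 \<le> y" "y \<le> x" "star_val ns y = 0"
  shows "star_val ns x \<ge> x - y"
proof -
  have "y - (\<Sum>n\<leftarrow>ns. branch n y) = 0"
    using star_val_ge_2[OF assms(1), of ns] forest_val_ge_1[OF assms(1), of ns] assms(3) by auto
  moreover have "(\<Sum>n\<leftarrow>ns. branch n x) \<le> (\<Sum>n\<leftarrow>ns. branch n y)"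
    using assms by (intro sum_list_mono branch_antimono) auto
  ultimately have *: "x - (\<Sum>n\<leftarrow>ns. branch n x) \<ge> x - y" by simp
  then have "forest_val ns x * (x - (\<Sum>n\<leftarrow>ns. branch n x)) \<ge> 1 * (x - y)"
    using forest_val_ge_1[of x ns] assms by (intro mult_mono) auto
  then show ?thesis using star_val_ge_2[of x ns] assms by simp
qed

lemma star_val_root_ge_2_unique:
  fixes x y :: real
  assumes "2 \<le> x" "2 \<le> y" "star_val ns x = 0" "star_val ns y = 0"
  shows "x = y"
  using star_val_growth[of x y ns] star_val_growth[of y x ns] assms by linarith

text \<open>Each branch contributes less than 1, so \<open>x\<close> outweighs all of them
  together.\<close>

lemma star_val_eventually_pos:
  fixes x :: real
  assumes "x \<ge> 2" "x > length ns"
  shows "star_val ns x > 0"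
proof -
  have "(\<Sum>n\<leftarrow>ns. branch n x) \<le> (\<Sum>n\<leftarrow>ns. 1)"
    using branch_ge_2[OF assms(1)] by (intro sum_list_mono) (auto intro: less_imp_le)
  then have "x - (\<Sum>n\<leftarrow>ns. branch n x) > 0" using assms(2) by (simp add: sum_list_triv)
  then show ?thesis using forest_val_ge_1[OF assms(1), of ns] by (simp add: star_val_ge_2[OF assms(1)])
qed

subsection \<open>Characteristic polynomials of starlike trees\<close>

text \<open>An explicit vertex list allows a chosen vertex to be moved to the front and then deleted
  as the head of the list.\<close>

definition adj_poly :: "('v \<Rightarrow> 'v \<Rightarrow> bool) \<Rightarrow> 'v list \<Rightarrow> 'c::comm_ring_1 poly" where
  "adj_poly E vs = char_poly (Matrix.mat (length vs) (length vs)
     (\<lambda>(i, j). if E (vs ! i) (vs ! j) then 1 else 0))"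

definition adj_char_mat :: "('v \<Rightarrow> 'v \<Rightarrow> bool) \<Rightarrow> 'v list \<Rightarrow> 'c::comm_ring_1 poly mat" where
  "adj_char_mat E vs = Matrix.mat (length vs) (length vs)
     (\<lambda>(i, j). (if i = j then [:0, 1:] else 0) - (if E (vs ! i) (vs ! j) then 1 else 0))"

lemma adj_char_mat_carrier [simp]: "adj_char_mat E vs \<in> carrier_mat (length vs) (length vs)"
  by (simp add: adj_char_mat_def)

lemma adj_poly_det: "adj_poly E vs = det (adj_char_mat E vs)"
  unfolding adj_poly_def char_poly_defs
  by (rule arg_cong[of _ _ det], rule eq_matI) (auto simp: adj_char_mat_def one_pCons simp del: pCons_one)

text \<open>The same permutation acts on rows and on columns, so its sign enters twice and
  cancels.\<close>

lemma adj_poly_permute: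
  assumes "distinct vs" "distinct ws" "set vs = set ws"
  shows "(adj_poly E vs :: 'c::comm_ring_1 poly) = adj_poly E ws"
proof -
  from assms have "mset vs = mset ws" by (simp add: set_eq_iff_mset_eq_distinct)
  then obtain p where p: "p permutes {..<length ws}" "permute_list p ws = vs"
    by (rule mset_eq_permutation)
  let ?n = "length ws" and ?A = "adj_char_mat E ws :: 'c poly mat"
  have p': "p permutes {0..<?n}" using p(1) by (simp add: atLeast0LessThan)
  have lt: "p i < ?n" if "i < ?n" for i using permutes_in_image[OF p(1)] that by simp
  have len: "length vs = ?n" using p(2) by auto
  have nth: "vs ! i = ws ! p i" if "i < ?n" for i
    using p that by (metis permute_list_nth)
  have inj: "p i = p j \<longleftrightarrow> i = j" for i j using permutes_inj[OF p(1)] by (auto dest: injD)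
  \<comment> \<open>In \<open>B\<close> only the rows are permuted; the columns are then treated as
    the rows of its transpose.\<close>
  define B where "B = Matrix.mat ?n ?n (\<lambda>(i, j). ?A $$ (p i, j))"
  have B: "B \<in> carrier_mat ?n ?n" by (simp add: B_def)
  have "adj_char_mat E vs = transpose_mat (Matrix.mat ?n ?n (\<lambda>(i, j). transpose_mat B $$ (p i, j)))"
    by (rule eq_matI) (auto simp: adj_char_mat_def B_def len nth lt inj)
  then have "det (adj_char_mat E vs :: 'c poly mat) =
      det (Matrix.mat ?n ?n (\<lambda>(i, j). transpose_mat B $$ (p i, j)))"
    by (simp add: det_transpose[of _ ?n])
  also have "\<dots> = of_int (sign p) * det (transpose_mat B)"
    using B by (intro det_permute_rows p') simp
  also have "det (transpose_mat B) = of_int (sign p) * det ?A"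
    using B det_permute_rows[of ?A ?n p] p' by (simp add: det_transpose[OF B]) (simp add: B_def)
  also have "of_int (sign p) * (of_int (sign p) * det ?A) = det ?A"
    by (simp add: mult.assoc[symmetric] flip: of_int_mult)
  finally show ?thesis by (simp add: adj_poly_det)
qed

lemma mat_delete_adj_char_mat_Cons:
  "mat_delete (adj_char_mat E (v # vs)) 0 0 = adj_char_mat E vs"
  by (rule eq_matI) (auto simp: mat_delete_def adj_char_mat_def)

lemma adj_poly_Nil [simp]: "adj_poly E [] = 1"
  by (simp add: adj_poly_det adj_char_mat_def)

lemma adj_poly_isolated:
  assumes "\<And>w. w \<in> set (v # vs) \<Longrightarrow> \<not> E v w"
  shows "(adj_poly E (v # vs) :: 'c::comm_ring_1 poly) = [:0, 1:] * adj_poly E vs"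
proof -
  let ?A = "adj_char_mat E (v # vs) :: 'c poly mat" and ?n = "Suc (length vs)"
  have row: "?A $$ (0, j) = (if j = 0 then [:0, 1:] else 0)" if "j < ?n" for j
  proof -
    have "(v # vs) ! j \<in> set (v # vs)" using that by (intro nth_mem) simp
    with that assms show ?thesis by (auto simp: adj_char_mat_def)
  qed
  have "det ?A = (\<Sum>j<?n. ?A $$ (0, j) * cofactor ?A 0 j)"
    by (rule laplace_expansion_row) (auto simp: adj_char_mat_def)
  also have "\<dots> = (\<Sum>j<?n. if j = 0 then [:0, 1:] * cofactor ?A 0 0 else 0)"
    by (rule sum.cong) (auto simp: row)
  also have "\<dots> = [:0, 1:] * det (mat_delete ?A 0 0)"
    by (simp add: cofactor_def)
  finally show ?thesis by (simp add: adj_poly_det mat_delete_adj_char_mat_Cons)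
qed

text \<open>Laplace expansion along the row of the leaf \<open>v\<close>, whose only entries are x
  and -1; the minor of the latter is expanded along the column of \<open>v\<close>.\<close>

lemma adj_poly_leaf:
  assumes "distinct (v # w # vs)"
    and v: "\<And>x. x \<in> set (v # w # vs) \<Longrightarrow> E v x \<longleftrightarrow> x = w"
    and v': "\<And>x. x \<in> set (v # w # vs) \<Longrightarrow> E x v \<longleftrightarrow> x = w"
  shows "(adj_poly E (v # w # vs) :: 'c::comm_ring_1 poly) =
    [:0, 1:] * adj_poly E (w # vs) - adj_poly E vs"
proof -
  let ?n = "Suc (Suc (length vs))"
  define A where "A = (adj_char_mat E (v # w # vs) :: 'c poly mat)"
  \<comment> \<open>The minor at the entry of \<open>v\<close> and \<open>w\<close>. Its first
    column is still that of \<open>v\<close>, with the single entry -1 in the row of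
    \<open>w\<close>.\<close>
  define D where "D = mat_delete A 0 (Suc 0)"
  have A: "A \<in> carrier_mat ?n ?n"
    by (simp add: A_def adj_char_mat_def)
  have eq_w: "(v # w # vs) ! j = w \<longleftrightarrow> j = 1" if "j < ?n" for j
    using nth_eq_iff_index_eq[OF assms(1), of j 1] that by simp
  have row: "A $$ (0, j) = (if j = 0 then [:0, 1:] else if j = 1 then -1 else 0)" if "j < ?n" for j
  proof -
    have "(v # w # vs) ! j \<in> set (v # w # vs)" using that by (intro nth_mem) simp
    from v[OF this] that assms(1) eq_w[OF that] show ?thesis by (auto simp: A_def adj_char_mat_def)
  qed
  have col: "A $$ (j, 0) = (if j = 0 then [:0, 1:] else if j = 1 then -1 else 0)" if "j < ?n" for j
  proof -
    have "(v # w # vs) ! j \<in> set (v # w # vs)" using that by (intro nth_mem) simp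
    from v'[OF this] that assms(1) eq_w[OF that] show ?thesis by (auto simp: A_def adj_char_mat_def)
  qed
  have D: "D \<in> carrier_mat (Suc (length vs)) (Suc (length vs))"
    by (simp add: D_def A_def mat_delete_def adj_char_mat_def)
  have D_col: "D $$ (i, 0) = (if i = 0 then -1 else 0)" if "i < Suc (length vs)" for i
    using that col[of "Suc i"] by (auto simp: D_def A_def mat_delete_def adj_char_mat_def)
  have DD: "mat_delete D 0 0 = adj_char_mat E vs"
    by (rule eq_matI) (auto simp: D_def A_def mat_delete_def adj_char_mat_def)
  have "det D = (\<Sum>i<Suc (length vs). D $$ (i, 0) * cofactor D i 0)"
    by (rule laplace_expansion_column[OF D]) simp
  also have "\<dots> = (\<Sum>i<Suc (length vs). if i = 0 then - cofactor D 0 0 else 0)"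
    by (rule sum.cong) (auto simp: D_col)
  also have "\<dots> = - adj_poly E vs"
    by (simp add: cofactor_def DD adj_poly_det)
  finally have det_D: "det D = - adj_poly E vs" .
  have "det A = (\<Sum>j<?n. A $$ (0, j) * cofactor A 0 j)"
    by (rule laplace_expansion_row[OF A]) simp
  also have "\<dots> = (\<Sum>j\<in>{0, Suc 0}. A $$ (0, j) * cofactor A 0 j)"
    by (rule sum.mono_neutral_right) (auto simp: row)
  also have "\<dots> = [:0, 1:] * cofactor A 0 0 - cofactor A 0 (Suc 0)"
    by (simp add: row)
  also have "\<dots> = [:0, 1:] * adj_poly E (w # vs) - adj_poly E vs"
    using det_D by (simp add: cofactor_def adj_poly_det D_def A_def mat_delete_adj_char_mat_Cons)
  finally show ?thesis by (simp add: adj_poly_det A_def)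
qed

text \<open>Empty branches are allowed here, so that a branch may be shortened all the way down by removing
  leaves.\<close>

definition star_structure :: "('v \<Rightarrow> 'v \<Rightarrow> bool) \<Rightarrow> 'v \<Rightarrow> 'v list list \<Rightarrow> bool" where
  "star_structure E u ps \<longleftrightarrow> distinct (u # concat ps) \<and> \<not> E u u \<and>
     (\<forall>x\<in>set (concat ps). \<forall>y\<in>set (concat ps). E x y \<longleftrightarrow> (\<exists>p\<in>set ps. (x, y) \<in> path_ends p)) \<and>
     (\<forall>x\<in>set (concat ps). (E u x \<longleftrightarrow> (\<exists>p\<in>set ps. p \<noteq> [] \<and> x = hd p)) \<and> (E x u \<longleftrightarrow> E u x))"

section \<open>Edges of paths and removal of outer vertices\<close>

lemma path_ends_Nil [simp]: "path_ends [] = {}"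
  and path_ends_single [simp]: "path_ends [v] = {}"
  by (simp_all add: path_ends_def)

lemma path_ends_Cons_Cons: "path_ends (v # w # q) = insert (v, w) (insert (w, v) (path_ends (w # q)))"
  by (auto simp: path_ends_def)

lemma path_ends_snoc: "path_ends (q @ [w, v]) = insert (v, w) (insert (w, v) (path_ends (q @ [w])))"
proof (induction q)
  case (Cons a q)
  then show ?case by (cases q) (auto simp: path_ends_Cons_Cons)
qed (simp add: path_ends_Cons_Cons insert_commute)

lemma path_ends_subset: "path_ends p \<subseteq> set p \<times> set p"
  by (auto simp: path_ends_def dest: set_zip_leftD set_zip_rightD list.set_sel(2)[rotated])
    (metis list.sel(2) list.set_sel(2) set_zip_leftD set_zip_rightD)+

lemma star_structureD:
  assumes "star_structure E u ps"
  shows "distinct (u # concat ps)" and "\<not> E u u"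
    and "\<And>x y. x \<in> set (concat ps) \<Longrightarrow> y \<in> set (concat ps) \<Longrightarrow> E x y \<longleftrightarrow> (\<exists>p\<in>set ps. (x, y) \<in> path_ends p)"
    and "\<And>x. x \<in> set (concat ps) \<Longrightarrow> E u x \<longleftrightarrow> (\<exists>p\<in>set ps. p \<noteq> [] \<and> x = hd p)"
    and "\<And>x. x \<in> set (concat ps) \<Longrightarrow> E x u \<longleftrightarrow> E u x"
  using assms unfolding star_structure_def by blast+

lemma star_structure_hd_disjoint:
  assumes "distinct (concat (p # ps))" "q \<in> set ps" "x \<in> set p"
  shows "(x, y) \<notin> path_ends q" and "(y, x) \<notin> path_ends q" and "\<not> (q \<noteq> [] \<and> x = hd q)"
proof -
  have "x \<notin> set q" using assms by auto
  then show "(x, y) \<notin> path_ends q" "(y, x) \<notin> path_ends q" "\<not> (q \<noteq> [] \<and> x = hd q)"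
    using path_ends_subset[of q] hd_in_set[of q] by blast+
qed

lemma star_structure_tl:
  assumes st: "star_structure E u (p # ps)"
  shows "star_structure E u ps"
proof -
  note D = star_structureD[OF st]
  have disj: "(x, y) \<notin> path_ends p" "\<not> (p \<noteq> [] \<and> x = hd p)" if "x \<in> set (concat ps)" for x y
  proof -
    have "x \<notin> set p" using D(1) that by auto
    then show "(x, y) \<notin> path_ends p" "\<not> (p \<noteq> [] \<and> x = hd p)"
      using path_ends_subset[of p] hd_in_set[of p] by blast+
  qed
  show ?thesis unfolding star_structure_def
  proof (intro conjI ballI)
    show "distinct (u # concat ps)" "\<not> E u u" using D(1,2) by simp_all
    fix x assume x: "x \<in> set (concat ps)"
    then have x': "x \<in> set (concat (p # ps))" by simp
    show "E u x \<longleftrightarrow> (\<exists>p\<in>set ps. p \<noteq> [] \<and> x = hd p)" using D(4)[OF x'] disj(2)[OF x] by simp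
    show "E x u \<longleftrightarrow> E u x" by (rule D(5)[OF x'])
    fix y assume "y \<in> set (concat ps)"
    then have y': "y \<in> set (concat (p # ps))" by simp
    show "E x y \<longleftrightarrow> (\<exists>p\<in>set ps. (x, y) \<in> path_ends p)" using D(3)[OF x' y'] disj(1)[OF x] by simp
  qed
qed

lemma star_structure_butlast:
  assumes st: "star_structure E u ((q @ [v]) # ps)"
  shows "star_structure E u (q # ps)"
proof -
  note D = star_structureD[OF st]
  have v: "v \<notin> set (concat (q # ps))" using D(1) by auto
  have ends: "(x, y) \<in> path_ends (q @ [v]) \<longleftrightarrow> (x, y) \<in> path_ends q" if "x \<noteq> v" "y \<noteq> v" for x y
    using that by (cases q rule: rev_cases) (simp_all add: path_ends_snoc)
  have hd: "x = hd (q @ [v]) \<longleftrightarrow> q \<noteq> [] \<and> x = hd q" if "x \<noteq> v" for x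
    using that by (cases q) simp_all
  show ?thesis unfolding star_structure_def
  proof (intro conjI ballI)
    show "distinct (u # concat (q # ps))" "\<not> E u u" using D(1,2) by simp_all
    fix x assume x: "x \<in> set (concat (q # ps))"
    then have x': "x \<in> set (concat ((q @ [v]) # ps))" and xv: "x \<noteq> v" using v by auto
    show "E u x \<longleftrightarrow> (\<exists>p\<in>set (q # ps). p \<noteq> [] \<and> x = hd p)" using D(4)[OF x'] hd[OF xv] by simp
    show "E x u \<longleftrightarrow> E u x" by (rule D(5)[OF x'])
    fix y assume "y \<in> set (concat (q # ps))"
    then have y': "y \<in> set (concat ((q @ [v]) # ps))" and yv: "y \<noteq> v" using v by auto
    show "E x y \<longleftrightarrow> (\<exists>p\<in>set (q # ps). (x, y) \<in> path_ends p)" using D(3)[OF x' y'] ends[OF xv yv] by simp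
  qed
qed

text \<open>Distinctness keeps \<open>v\<close> off the other branches, and as \<open>w\<close>
  precedes it in its own branch, \<open>v\<close> is not the vertex joined to the center.\<close>

lemma star_structure_leaf:
  assumes st: "star_structure E u ((q @ [w, v]) # ps)" and x: "x \<in> set (u # v # w # q @ concat ps)"
  shows "E v x \<longleftrightarrow> x = w" and "E x v \<longleftrightarrow> x = w"
proof -
  note D = star_structureD[OF st]
  have v: "v \<in> set (concat ((q @ [w, v]) # ps))" by simp
  have disj: "(v, y) \<notin> path_ends p" "(y, v) \<notin> path_ends p" "\<not> (p \<noteq> [] \<and> v = hd p)"
    if "p \<in> set ps" for p y
    using star_structure_hd_disjoint[of "q @ [w, v]" ps p v] D(1) that by auto
  have hd: "v \<noteq> hd (q @ [w, v])" using D(1) by (cases q) auto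
  have u: "\<not> E u v" "\<not> E v u" using D(4,5)[OF v] hd disj(3) by auto
  have "v \<notin> set (q @ [w])" using D(1) by auto
  then have ends: "(v, y) \<in> path_ends (q @ [w, v]) \<longleftrightarrow> y = w" "(y, v) \<in> path_ends (q @ [w, v]) \<longleftrightarrow> y = w" for y
    using path_ends_subset[of "q @ [w]"] by (auto simp: path_ends_snoc)
  have "w \<noteq> u" using D(1) by auto
  moreover have "E v x \<longleftrightarrow> x = w" "E x v \<longleftrightarrow> x = w" if "x \<noteq> u"
  proof -
    from x that have x': "x \<in> set (concat ((q @ [w, v]) # ps))" by auto
    show "E v x \<longleftrightarrow> x = w" "E x v \<longleftrightarrow> x = w"
      using D(3)[OF v x'] D(3)[OF x' v] ends disj(1,2) by auto
  qed
  ultimately show "E v x \<longleftrightarrow> x = w" "E x v \<longleftrightarrow> x = w" using u by auto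
qed

text \<open>The first claim serves the forest without the center, where the vertex is isolated; the
  other two serve the star, where it is a leaf at the center.\<close>

lemma star_structure_single:
  assumes st: "star_structure E u ([v] # ps)"
  shows "\<And>x. x \<in> set (v # concat ps) \<Longrightarrow> \<not> E v x"
    and "\<And>x. x \<in> set (v # u # concat ps) \<Longrightarrow> E v x \<longleftrightarrow> x = u"
    and "\<And>x. x \<in> set (v # u # concat ps) \<Longrightarrow> E x v \<longleftrightarrow> x = u"
proof -
  note D = star_structureD[OF st]
  have v: "v \<in> set (concat ([v] # ps))" by simp
  have disj: "(v, y) \<notin> path_ends p" "(y, v) \<notin> path_ends p" if "p \<in> set ps" for p y
    using star_structure_hd_disjoint[of "[v]" ps p v] D(1) that by auto
  have no: "\<not> E v x" "\<not> E x v" if "x \<in> set (v # concat ps)" for x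
  proof -
    from that have x: "x \<in> set (concat ([v] # ps))" by simp
    show "\<not> E v x" "\<not> E x v" using D(3)[OF v x] D(3)[OF x v] disj by auto
  qed
  have u: "E u v" "E v u" using D(4,5)[OF v] by auto
  have "u \<notin> set (v # concat ps)" using D(1) by auto
  then show "\<And>x. x \<in> set (v # concat ps) \<Longrightarrow> \<not> E v x"
    and "\<And>x. x \<in> set (v # u # concat ps) \<Longrightarrow> E v x \<longleftrightarrow> x = u"
    and "\<And>x. x \<in> set (v # u # concat ps) \<Longrightarrow> E x v \<longleftrightarrow> x = u"
    using no u by auto
qed

text \<open>Removing the leaf at the outer end leads to branches shorter by one and by two, which is
  the recursion of \<open>path_val\<close>; hence the strong induction.\<close>

lemma adj_poly_forest_Cons:
  "star_structure E u (p # ps) \<Longrightarrow>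
    adj_poly E (concat (p # ps)) = path_val (length p) [:0, 1:] * (adj_poly E (concat ps) :: 'c::comm_ring_1 poly)"
proof (induction p rule: length_induct)
  case (1 p)
  have d: "distinct (concat (p # ps))" using 1(2) by (simp add: star_structure_def)
  consider "p = []" | v where "p = [v]" | q w v where "p = q @ [w, v]"
    by (metis append_Cons append_Nil append_assoc rev_exhaust)
  then show ?case
  proof cases
    case 2
    have "(adj_poly E (v # concat ps) :: 'c poly) = [:0, 1:] * adj_poly E (concat ps)"
      using star_structure_single(1)[of E u v ps] 1(2) 2 by (intro adj_poly_isolated) simp
    with 2 show ?thesis by simp
  next
    case 3
    have ring: "x * (a * f) - c * f = (x * a - c) * f" for x a c f :: "'c poly"
      by (simp add: algebra_simps)
    have st: "star_structure E u ((q @ [w]) # ps)" "star_structure E u (q # ps)"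
      using 1(2) 3 star_structure_butlast[of E u "q @ [w]" v ps] star_structure_butlast[of E u q w ps] by auto
    \<comment> \<open>Reordering brings the outer end \<open>v\<close> and its neighbour
      \<open>w\<close> to the front, where the leaf rule applies.\<close>
    have "(adj_poly E (concat (p # ps)) :: 'c poly) = adj_poly E (v # w # q @ concat ps)"
      using d 3 by (intro adj_poly_permute) auto
    also have "\<dots> = [:0, 1:] * adj_poly E (w # q @ concat ps) - adj_poly E (q @ concat ps)"
      using d 3 star_structure_leaf[of E u q w v ps] 1(2) by (intro adj_poly_leaf) auto
    also have "adj_poly E (w # q @ concat ps) = (adj_poly E (concat ((q @ [w]) # ps)) :: 'c poly)"
      using d 3 by (intro adj_poly_permute) auto
    also have "\<dots> = path_val (length (q @ [w])) [:0, 1:] * adj_poly E (concat ps)"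
      using 1(1)[rule_format, of "q @ [w]"] st(1) 3 by simp
    also have "adj_poly E (q @ concat ps) = path_val (length q) [:0, 1:] * (adj_poly E (concat ps) :: 'c poly)"
      using 1(1) st(2) 3 by simp
    finally have "(adj_poly E (concat (p # ps)) :: 'c poly) =
        [:0, 1:] * (path_val (Suc (length q)) [:0, 1:] * adj_poly E (concat ps))
        - path_val (length q) [:0, 1:] * adj_poly E (concat ps)"
      by (simp only: length_append_singleton)
    also have "\<dots> = path_val (Suc (Suc (length q))) [:0, 1:] * adj_poly E (concat ps)"
      unfolding path_val.simps(3) by (rule ring)
    finally show ?thesis using 3 by simp
  qed simp
qed

lemma adj_poly_forest:
  "star_structure E u ps \<Longrightarrow> adj_poly E (concat ps) = forest_val (map length ps) [:0, 1:]"
proof (induction ps)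
  case (Cons p ps)
  then show ?case
    by (simp only: adj_poly_forest_Cons[OF Cons(2)] Cons(1)[OF star_structure_tl[OF Cons(2)]]) simp
qed simp

text \<open>Both coefficients, \<open>path_val\<close> and \<open>path_val_pred\<close>, satisfy the
  recursion produced by removing a leaf. The branches of length 0 and 1 start the induction.\<close>

lemma adj_poly_star_Cons:
  "star_structure E u (p # ps) \<Longrightarrow>
    adj_poly E (u # concat (p # ps)) = path_val (length p) [:0, 1:] * (adj_poly E (u # concat ps) :: 'c::comm_ring_1 poly)
      - path_val_pred (length p) [:0, 1:] * adj_poly E (concat ps)"
proof (induction p rule: length_induct)
  case (1 p)
  have d: "distinct (u # concat (p # ps))" using 1(2) by (simp add: star_structure_def)
  consider "p = []" | v where "p = [v]" | q w v where "p = q @ [w, v]"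
    by (metis append_Cons append_Nil append_assoc rev_exhaust)
  then show ?case
  proof cases
    case 2
    \<comment> \<open>The single vertex of the branch is a leaf at \<open>u\<close>; deleting both
      leaves just the other branches.\<close>
    have "(adj_poly E (u # concat (p # ps)) :: 'c poly) = adj_poly E (v # u # concat ps)"
      using d 2 by (intro adj_poly_permute) auto
    also have "\<dots> = [:0, 1:] * adj_poly E (u # concat ps) - adj_poly E (concat ps)"
      using d 2 star_structure_single(2,3)[of E u v ps] 1(2) by (intro adj_poly_leaf) auto
    finally show ?thesis using 2 by simp
  next
    case 3
    have st: "star_structure E u ((q @ [w]) # ps)" "star_structure E u (q # ps)"
      using 1(2) 3 star_structure_butlast[of E u "q @ [w]" v ps] star_structure_butlast[of E u q w ps] by auto
    have ring: "x * (a * s - b * f) - (c * s - d * f) = (x * a - c) * s - (x * b - d) * f"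
      for x a b c d s f :: "'c poly"
      by (simp add: algebra_simps)
    let ?S = "adj_poly E (u # concat ps) :: 'c poly" and ?F = "adj_poly E (concat ps) :: 'c poly"
    have "(adj_poly E (u # concat (p # ps)) :: 'c poly) = adj_poly E (v # w # u # q @ concat ps)"
      using d 3 by (intro adj_poly_permute) auto
    also have "\<dots> = [:0, 1:] * adj_poly E (w # u # q @ concat ps) - adj_poly E (u # q @ concat ps)"
      using d 3 star_structure_leaf[of E u q w v ps] 1(2) by (intro adj_poly_leaf) auto
    also have "adj_poly E (w # u # q @ concat ps) = (adj_poly E (u # concat ((q @ [w]) # ps)) :: 'c poly)"
      using d 3 by (intro adj_poly_permute) auto
    also have "\<dots> = path_val (Suc (length q)) [:0, 1:] * ?S - path_val_pred (Suc (length q)) [:0, 1:] * ?F"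
      using 1(1)[rule_format, of "q @ [w]"] st(1) 3 by simp
    also have "adj_poly E (u # q @ concat ps) =
        path_val (length q) [:0, 1:] * ?S - path_val_pred (length q) [:0, 1:] * ?F"
      using 1(1) st(2) 3 by simp
    finally have "(adj_poly E (u # concat (p # ps)) :: 'c poly) =
        [:0, 1:] * (path_val (Suc (length q)) [:0, 1:] * ?S - path_val_pred (Suc (length q)) [:0, 1:] * ?F)
        - (path_val (length q) [:0, 1:] * ?S - path_val_pred (length q) [:0, 1:] * ?F)" .
    also have "\<dots> = path_val (Suc (Suc (length q))) [:0, 1:] * ?S -
        path_val_pred (Suc (Suc (length q))) [:0, 1:] * ?F"
      unfolding path_val_pred_Suc_Suc path_val.simps(3) by (rule ring)
    finally show ?thesis using 3 by simp
  qed simp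
qed

lemma adj_poly_star:
  "star_structure E u ps \<Longrightarrow> adj_poly E (u # concat ps) = star_val (map length ps) [:0, 1:]"
proof (induction ps)
  case (Cons p ps)
  note tl = star_structure_tl[OF Cons(2)]
  show ?case
    by (simp only: adj_poly_star_Cons[OF Cons(2)] adj_poly_forest[OF tl] Cons(1)[OF tl]) simp
next
  case Nil
  then have "adj_poly E [u] = [:0, 1:] * adj_poly E []"
    by (intro adj_poly_isolated) (simp add: star_structure_def)
  then show ?case by simp
qed

subsection \<open>An eigenvalue above the square root of three\<close>

lemma sum_list_map_pos:
  fixes f :: "'a \<Rightarrow> real"
  shows "xs \<noteq> [] \<Longrightarrow> (\<And>x. x \<in> set xs \<Longrightarrow> f x > 0) \<Longrightarrow> (\<Sum>x\<leftarrow>xs. f x) > 0"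
proof (induction xs)
  case (Cons a xs)
  then show ?case by (cases xs) (auto intro: add_pos_pos)
qed simp

text \<open>Path polynomials are Chebyshev polynomials of the second kind at x / 2. The multiplied
  form avoids dividing by \<open>sin t\<close>.\<close>

lemma sin_mult_path_val: "sin t * path_val n (2 * cos t) = sin (real (Suc n) * t)"
proof (induction n "2 * cos t" rule: path_val.induct)
  case 2
  show ?case by (simp add: sin_double)
next
  case (3 n)
  have "sin (real (Suc (Suc (Suc n))) * t) + sin (real (Suc n) * t) = 2 * cos t * sin (real (Suc (Suc n)) * t)"
    using sin_plus_sin[of "real (Suc (Suc (Suc n))) * t" "real (Suc n) * t"]
    by (simp add: algebra_simps add_divide_distrib diff_divide_distrib)
  with 3 show ?case by (simp add: algebra_simps)
qed simp

text \<open>At the largest root of \<open>path_val (N + 1)\<close> the longest branch alone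
  contributes exactly \<open>z\<close>, and any further branch a positive amount, so the second
  factor of the branch form is negative.\<close>

lemma star_val_neg_of_long_branch:
  assumes "length ns \<ge> 2" "0 \<notin> set ns" and N: "N = Max (set ns)" "N \<ge> 4"
  shows "\<exists>z::real. sqrt 3 \<le> z \<and> z \<le> 2 \<and> star_val ns z < 0"
proof -
  \<comment> \<open>This makes \<open>sin ((N + 2) * t)\<close> vanish, and
    \<open>N + 2 \<ge> 6\<close> gives \<open>t \<le> pi / 6\<close>, hence
    \<open>z \<ge> sqrt 3\<close>.\<close>
  define t where "t = pi / real (N + 2)"
  define z where "z = 2 * cos t"
  have t: "0 < t" "t \<le> pi / 6" using N by (auto simp: t_def field_simps)
  have sin_t: "sin t > 0" using t pi_gt_zero by (intro sin_gt_zero) linarith+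
  have "cos (pi / 6) \<le> cos t" using t pi_gt_zero by (intro cos_monotone_0_pi_le) linarith+
  then have z: "sqrt 3 \<le> z" "z \<le> 2" by (simp_all add: z_def cos_30)
  have pos: "path_val k z > 0" if "k \<le> N" for k
  proof -
    have "pi * real (Suc k) < pi * real (N + 2)" using that by (intro mult_strict_left_mono) auto
    then have "real (Suc k) * t < pi" by (simp add: t_def field_simps)
    then have "sin t * path_val k z > 0"
      unfolding z_def sin_mult_path_val using t by (intro sin_gt_zero) auto
    then show ?thesis using sin_t by (simp add: zero_less_mult_iff)
  qed
  \<comment> \<open>A zero of \<open>path_val (Suc N)\<close> is a fixed value
    \<open>branch N z = z\<close>.\<close>
  have "sin t * path_val (Suc N) z = 0"
    unfolding z_def sin_mult_path_val by (simp add: t_def)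
  then have "path_val N z * (z - branch N z) = 0"
    using sin_t pos[of N] by (simp add: path_val_Suc_branch)
  then have branch_N: "branch N z = z" using pos[of N] by auto
  have le: "k \<le> N" if "k \<in> set ns" for k using that N by simp
  have branch_pos: "branch k z > 0" if "k \<in> set ns" for k
  proof (cases k)
    case (Suc m)
    then show ?thesis using pos[of k] pos[of m] le[OF that] by (simp add: branch_def)
  qed (use that assms(2) in auto)
  have "set ns \<noteq> {}" using assms(1) by auto
  then have N_in: "N \<in> set ns" using N(1) by simp
  have "length (remove1 N ns) \<ge> 1" using assms(1) N_in by (simp add: length_remove1)
  then have "(\<Sum>k\<leftarrow>remove1 N ns. branch k z) > 0"
    using set_remove1_subset[of N ns] by (intro sum_list_map_pos branch_pos) auto
  then have "z - (\<Sum>k\<leftarrow>ns. branch k z) < 0"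
    using N_in branch_N by (simp add: sum_list_map_remove1)
  moreover have "forest_val ns z > 0"
    using le pos unfolding forest_val_def by (induction ns) auto
  moreover have "star_val ns z = forest_val ns z * (z - (\<Sum>k\<leftarrow>ns. branch k z))"
    by (rule star_val_branch) (use le pos in force)
  ultimately have "star_val ns z < 0" by (simp add: mult_pos_neg)
  with z show ?thesis by blast
qed

text \<open>For the claw the three terms \<open>1 / sqrt 3\<close> add up to exactly
  \<open>sqrt 3\<close>. Every branch contributes at least that much, and a fourth or a longer
  branch makes the sum strictly larger. Up to length 4 the path values at \<open>sqrt 3\<close> are
  positive, so the branch form applies.\<close>

lemma star_val_neg_of_short_branches:
  assumes "length ns \<ge> 3" "0 \<notin> set ns" "\<And>n. n \<in> set ns \<Longrightarrow> n \<le> 4"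
    and "length ns \<ge> 4 \<or> (\<exists>n\<in>set ns. n \<ge> 2)"
  shows "star_val ns (sqrt 3) < 0"
proof -
  let ?z = "sqrt 3" and ?b = "1 / sqrt 3 :: real"
  have P: "path_val 1 ?z = ?z" "path_val 2 ?z = 2" "path_val 3 ?z = ?z" "path_val 4 ?z = 1"
    by (simp_all add: numeral_eq_Suc)
  have B: "branch 1 ?z = ?b" "branch 2 ?z = ?z / 2" "branch 3 ?z = 2 / ?z" "branch 4 ?z = ?z"
    by (simp_all add: branch_def numeral_eq_Suc)
  have *: "n = 1 \<or> n = 2 \<or> n = 3 \<or> n = 4" if "n \<in> set ns" for n
  proof -
    have "n \<noteq> 0" using that assms(2) by metis
    with assms(3)[OF that] show ?thesis by linarith
  qed
  have pos: "path_val n ?z > 0" if "n \<in> set ns" for n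
    using *[OF that] P by auto
  have gt: "branch n ?z > ?b" if "n \<in> set ns" "n \<ge> 2" for n
  proof -
    have "?b < ?z / 2" "?b < 2 / ?z" "?b < ?z" by (simp_all add: field_simps)
    then show ?thesis using *[OF that(1)] that(2) B(2-4) by (elim disjE) simp_all
  qed
  have ge: "branch n ?z - ?b \<ge> 0" if "n \<in> set ns" for n
    using gt[OF that] *[OF that] B(1) by fastforce
  have len: "(\<Sum>n\<leftarrow>xs. branch n ?z - ?b) = (\<Sum>n\<leftarrow>xs. branch n ?z) - real (length xs) * ?b" for xs
    by (induction xs) (simp_all add: algebra_simps add_divide_distrib)
  have nonneg: "(\<Sum>n\<leftarrow>xs. branch n ?z - ?b) \<ge> 0" if "set xs \<subseteq> set ns" for xs
    using that ge by (intro sum_list_nonneg) auto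
  have b: "3 * ?b = ?z" by (simp add: field_simps)
  have "(\<Sum>n\<leftarrow>ns. branch n ?z) > 3 * ?b"
  proof (cases "length ns \<ge> 4")
    case True
    have "(\<Sum>n\<leftarrow>ns. branch n ?z) \<ge> real (length ns) * ?b" using nonneg[of ns] len[of ns] by simp
    moreover have "real (length ns) * ?b \<ge> 4 * ?b" using True by (intro mult_right_mono) auto
    moreover have "?b > 0" by simp
    ultimately show ?thesis by linarith
  next
    case False
    with assms obtain n where n: "n \<in> set ns" "n \<ge> 2" by blast
    have "(\<Sum>n\<leftarrow>ns. branch n ?z - ?b) = (branch n ?z - ?b) + (\<Sum>n\<leftarrow>remove1 n ns. branch n ?z - ?b)"
      using n(1) by (rule sum_list_map_remove1)
    also have "\<dots> > 0" using gt[OF n] nonneg[of "remove1 n ns"] set_remove1_subset[of n ns] by linarith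
    finally have "(\<Sum>n\<leftarrow>ns. branch n ?z) > real (length ns) * ?b" unfolding len by simp
    moreover have "real (length ns) * ?b \<ge> 3 * ?b" using assms(1) by (intro mult_right_mono) auto
    ultimately show ?thesis by linarith
  qed
  then have "?z - (\<Sum>k\<leftarrow>ns. branch k ?z) < 0" using b by linarith
  moreover have "forest_val ns ?z > 0"
    using pos unfolding forest_val_def by (induction ns) auto
  moreover have "star_val ns ?z = forest_val ns ?z * (?z - (\<Sum>k\<leftarrow>ns. branch k ?z))"
    by (rule star_val_branch) (use pos in force)
  ultimately show ?thesis by (simp add: mult_pos_neg)
qed

text \<open>Intermediate value theorem between a negative value at some
  \<open>z \<ge> sqrt 3\<close> and a positive value far to the right.\<close>

lemma star_val_root_gt_sqrt_3:
  assumes "length ns \<ge> 3" "0 \<notin> set ns" "length ns \<ge> 4 \<or> (\<exists>n\<in>set ns. n \<ge> 2)"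
  shows "\<exists>x::real. x > sqrt 3 \<and> star_val ns x = 0"
proof -
  have "\<exists>z::real. sqrt 3 \<le> z \<and> z \<le> 2 \<and> star_val ns z < 0"
  proof (cases "Max (set ns) \<ge> 4")
    case True
    with assms show ?thesis by (intro star_val_neg_of_long_branch[OF _ _ refl]) auto
  next
    case False
    then have "n \<le> 4" if "n \<in> set ns" for n using Max_ge[OF finite_set that] by linarith
    then have "star_val ns (sqrt 3) < 0" using assms by (intro star_val_neg_of_short_branches) auto
    moreover have "sqrt 3 \<le> 2" by (simp add: real_le_lsqrt)
    ultimately show ?thesis by blast
  qed
  then obtain z :: real where z: "sqrt 3 \<le> z" "z \<le> 2" "star_val ns z < 0" by blast
  \<comment> \<open>\<open>?M\<close> exceeds both 2 and the number of branches, as eventual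
    positivity requires.\<close>
  let ?p = "star_val ns [:0, 1:] :: real poly" and ?M = "real (length ns) + 3"
  have poly: "poly ?p x = star_val ns x" for x by (simp add: poly_star_val)
  have "\<exists>x. z < x \<and> x < ?M \<and> poly ?p x = 0"
  proof (rule poly_IVT_pos)
    show "z < ?M" using z(2) by simp
    show "poly ?p z < 0" unfolding poly by (rule z(3))
    show "poly ?p ?M > 0" unfolding poly by (rule star_val_eventually_pos) simp_all
  qed
  then obtain x where "z < x" "poly ?p x = 0" by blast
  then show ?thesis using z(1) unfolding poly by (intro exI[of _ x]) simp
qed

subsection \<open>Products of elementary factors\<close>

definition elementary_product :: "nat \<Rightarrow> nat \<Rightarrow> nat \<Rightarrow> nat \<Rightarrow> nat \<Rightarrow> rat poly" where
  "elementary_product t1 t2 t3 t4 t5 =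
     [:0, 1:] ^ t1 * [:-1, 0, 1:] ^ t2 * [:-2, 0, 1:] ^ t3 *
     ([:-1, -1, 1:] * [:-1, 1, 1:]) ^ t4 * [:-3, 0, 1:] ^ t5"

text \<open>The irreducible constituents of the elementary products, with x^2 - 1 split. All their
  roots are real and lie strictly between -2 and 2.\<close>

definition elementary_factors :: "rat poly set" where
  "elementary_factors = {[:0, 1:], [:-1, 1:], [:1, 1:], [:-2, 0, 1:], [:-1, -1, 1:], [:-1, 1, 1:], [:-3, 0, 1:]}"

text \<open>The polynomial \<open>q(-x)\<close>, with the sign chosen such that monic polynomials stay monic.\<close>

definition flip :: "'a::idom poly \<Rightarrow> 'a poly" where
  "flip q = smult ((-1) ^ degree q) (q \<circ>\<^sub>p [:0, -1:])"

lemma flip_mult: "p \<noteq> 0 \<Longrightarrow> q \<noteq> 0 \<Longrightarrow> flip (p * q) = flip p * flip q"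
  by (simp add: flip_def degree_mult_eq pcompose_mult power_add mult.commute)

lemma degree_flip [simp]: "degree (flip q) = degree q"
  by (simp add: flip_def degree_pcompose)

lemma monic_flip:
  fixes q :: "'a::idom poly"
  shows "monic q \<Longrightarrow> monic (flip q)"
proof -
  assume "monic q"
  have "lead_coeff (flip q) = (-1) ^ degree q * (lead_coeff q * lead_coeff [:0, -1 :: 'a:] ^ degree q)"
    unfolding flip_def lead_coeff_smult by (subst lead_coeff_comp) simp_all
  then show "monic (flip q)" using \<open>monic q\<close> by (simp flip: power_mult_distrib)
qed

lemma flip_flip [simp]:
  fixes q :: "'a::idom poly"
  shows "flip (flip q) = q"
proof -
  have "q \<circ>\<^sub>p [:0, -1:] \<circ>\<^sub>p [:0, -1:] = q"
  proof -
    have "[:0, -1:] \<circ>\<^sub>p [:0, -1:] = [:0, 1 :: 'a:]" by (simp add: pcompose_pCons)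
    then show ?thesis by (metis pcompose_assoc pcompose_idR)
  qed
  then show ?thesis
    by (simp add: flip_def degree_pcompose pcompose_smult flip: power_mult_distrib)
qed

lemma flip_dvd:
  assumes "flip g = g" "q dvd g" "g \<noteq> 0"
  shows "flip q dvd g"
proof -
  from assms obtain h where "g = q * h" by (elim dvdE)
  with assms have "g = flip q * flip h" using flip_mult[of q h] by auto
  then show ?thesis by (rule dvdI)
qed

lemma flip_cancel:
  assumes "flip (Q * g) = Q * g" "flip Q = Q" "Q * g \<noteq> 0"
  shows "flip g = g"
  using assms flip_mult[of Q g] by auto

text \<open>The prime \<open>q\<close> cannot divide a different monic polynomial of the same
  degree, so it divides the cofactor of \<open>q'\<close>.\<close>

lemma irreducible_mult_dvd:
  fixes q q' g :: "'a::field_gcd poly"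
  assumes q: "irreducible q" "monic q" and q': "monic q'" "degree q' = degree q" "q' \<noteq> q"
    and dvd: "q dvd g" "q' dvd g"
  shows "q * q' dvd g"
proof -
  from dvd(2) obtain h where g: "g = q' * h" by (elim dvdE)
  have "prime_elem q" using q(1) by (rule field_poly_irreducible_imp_prime)
  with dvd(1) g have "q dvd q' \<or> q dvd h" by (simp add: prime_elem_dvd_mult_iff)
  moreover have "\<not> q dvd q'"
  proof
    assume "q dvd q'"
    then obtain c where c: "q' = q * c" by (elim dvdE)
    have "q \<noteq> 0" "c \<noteq> 0" using q' c by auto
    then have "degree c = 0" using c q'(2) by (simp add: degree_mult_eq)
    moreover have "lead_coeff c = 1" using c q(2) q'(1) by (metis lead_coeff_mult mult_1)
    ultimately have "c = 1" using monic_degree_0 by blast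
    with c q'(3) show False by simp
  qed
  ultimately show ?thesis using g by (metis dvd_refl mult.commute mult_dvd_mono)
qed

text \<open>Symmetry forces x - 1 and x + 1 to occur equally often, and likewise x^2 - x - 1 and x^2
  + x - 1. The induction splits off a symmetric factor each time, so that the cofactor stays
  symmetric.\<close>

lemma elementary_product_exists:
  assumes "monic g" "flip g = g"
    and "\<And>q. irreducible q \<Longrightarrow> monic q \<Longrightarrow> q dvd g \<Longrightarrow> q \<in> elementary_factors"
  shows "\<exists>t1 t2 t3 t4 t5. g = elementary_product t1 t2 t3 t4 t5"
  using assms
proof (induction "degree g" arbitrary: g rule: less_induct)
  case less
  show ?case
  proof (cases "degree g = 0")
    case True
    with less.prems(1) have "g = 1" by (metis degree_eq_zeroE lead_coeff_pCons(2) one_pCons)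
    then have "g = elementary_product 0 0 0 0 0" by (simp add: elementary_product_def)
    then show ?thesis by blast
  next
    case False
    have g0: "g \<noteq> 0" using less.prems(1) by auto
    from False irreducible_monic_factor[of g] obtain q where q: "irreducible q" "monic q" "q dvd g" by auto
    then have qL: "q \<in> elementary_factors" by (rule less.prems(3))
    have step: ?thesis
      if Q: "Q dvd g" "monic Q" "flip Q = Q" "degree Q > 0"
        and mult: "\<And>t1 t2 t3 t4 t5. \<exists>s1 s2 s3 s4 s5.
          Q * elementary_product t1 t2 t3 t4 t5 = elementary_product s1 s2 s3 s4 s5" for Q
    proof -
      from Q(1) obtain h where h: "g = Q * h" by (elim dvdE)
      have nz: "Q \<noteq> 0" "h \<noteq> 0" using g0 h by auto
      have "monic h" using less.prems(1) Q(2) h by (metis lead_coeff_mult mult_1)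
      moreover have "flip h = h" using flip_cancel[of Q h] less.prems(2) Q(3) g0 h by simp
      moreover have "degree h < degree g" using Q(4) nz by (simp add: h degree_mult_eq)
      moreover have "q \<in> elementary_factors" if "irreducible q" "monic q" "q dvd h" for q
        using less.prems(3)[OF that(1,2)] that(3) h by simp
      ultimately obtain t1 t2 t3 t4 t5 where "h = elementary_product t1 t2 t3 t4 t5"
        using less.hyps[of h] by blast
      with h mult show ?thesis by simp
    qed
    have flip_q: "flip q dvd g" using flip_dvd less.prems(2) q(3) g0 by blast
    \<comment> \<open>A factor that is not its own reflection is split off together with the
      reflection.\<close>
    have pair: "q * flip q dvd g" if "flip q \<noteq> q"
      using irreducible_mult_dvd[OF q(1,2) monic_flip[OF q(2)] _ that q(3) flip_q] by simp
    note flips = flip_def pcompose_pCons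
    note ep = elementary_product_def
    from qL consider "q = [:0, 1:]" | "q = [:-1, 1:] \<or> q = [:1, 1:]" | "q = [:-2, 0, 1:]"
      | "q = [:-1, -1, 1:] \<or> q = [:-1, 1, 1:]" | "q = [:-3, 0, 1:]"
      unfolding elementary_factors_def by blast
    then show ?thesis
    proof cases
      case 1
      have mult: "[:0, 1:] * elementary_product t1 t2 t3 t4 t5 = elementary_product (Suc t1) t2 t3 t4 t5"
        for t1 t2 t3 t4 t5 unfolding ep power_Suc by (simp only: mult_ac)
      show ?thesis
      proof (rule step)
        show "[:0, 1:] dvd g" using 1 q by simp
        show "\<exists>s1 s2 s3 s4 s5. [:0, 1:] * elementary_product t1 t2 t3 t4 t5 = elementary_product s1 s2 s3 s4 s5"
          for t1 t2 t3 t4 t5 by (intro exI) (rule mult)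
      qed (simp_all add: flips)
    next
      case 2
      have dvd: "[:-1, 0, 1:] dvd g" using 2 pair by (auto simp: flips one_pCons simp del: pCons_one)
      have mult: "[:-1, 0, 1:] * elementary_product t1 t2 t3 t4 t5 = elementary_product t1 (Suc t2) t3 t4 t5"
        for t1 t2 t3 t4 t5 unfolding ep power_Suc by (simp only: mult_ac)
      show ?thesis
      proof (rule step)
        show "[:-1, 0, 1:] dvd g" by (rule dvd)
        show "\<exists>s1 s2 s3 s4 s5. [:-1, 0, 1:] * elementary_product t1 t2 t3 t4 t5 = elementary_product s1 s2 s3 s4 s5"
          for t1 t2 t3 t4 t5 by (intro exI) (rule mult)
      qed (simp_all add: flips)
    next
      case 3
      have mult: "[:-2, 0, 1:] * elementary_product t1 t2 t3 t4 t5 = elementary_product t1 t2 (Suc t3) t4 t5"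
        for t1 t2 t3 t4 t5 unfolding ep power_Suc by (simp only: mult_ac)
      show ?thesis
      proof (rule step)
        show "[:-2, 0, 1:] dvd g" using 3 q by simp
        show "\<exists>s1 s2 s3 s4 s5. [:-2, 0, 1:] * elementary_product t1 t2 t3 t4 t5 = elementary_product s1 s2 s3 s4 s5"
          for t1 t2 t3 t4 t5 by (intro exI) (rule mult)
      qed (simp_all add: flips)
    next
      case 4
      \<comment> \<open>The product is x^4 - 3 x^2 + 1, an even polynomial and hence fixed by
        \<open>flip\<close>.\<close>
      define Q :: "rat poly" where "Q = [:-1, -1, 1:] * [:-1, 1, 1:]"
      have Q_eq: "Q = [:1, 0, -3, 0, 1:]" by (simp add: Q_def one_pCons del: pCons_one)
      have dvd: "Q dvd g" using 4 pair unfolding Q_eq by (auto simp: flips one_pCons simp del: pCons_one)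
      have mult: "Q * elementary_product t1 t2 t3 t4 t5 = elementary_product t1 t2 t3 (Suc t4) t5"
        for t1 t2 t3 t4 t5 unfolding ep power_Suc Q_def[symmetric] by (simp only: mult_ac)
      show ?thesis
      proof (rule step)
        show "Q dvd g" by (rule dvd)
        show "\<exists>s1 s2 s3 s4 s5. Q * elementary_product t1 t2 t3 t4 t5 = elementary_product s1 s2 s3 s4 s5"
          for t1 t2 t3 t4 t5 by (intro exI) (rule mult)
      qed (simp_all add: flips Q_eq one_pCons del: pCons_one)
    next
      case 5
      have mult: "[:-3, 0, 1:] * elementary_product t1 t2 t3 t4 t5 = elementary_product t1 t2 t3 t4 (Suc t5)"
        for t1 t2 t3 t4 t5 unfolding ep power_Suc by (simp only: mult_ac)
      show ?thesis
      proof (rule step)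
        show "[:-3, 0, 1:] dvd g" using 5 q by simp
        show "\<exists>s1 s2 s3 s4 s5. [:-3, 0, 1:] * elementary_product t1 t2 t3 t4 t5 = elementary_product s1 s2 s3 s4 s5"
          for t1 t2 t3 t4 t5 by (intro exI) (rule mult)
      qed (simp_all add: flips)
    qed
  qed
qed

subsection \<open>Irreducible factors\<close>

text \<open>A form of Gauss's lemma: the primitive integer multiple \<open>rg\<close> of
  \<open>g\<close> has leading coefficient 1 or -1, so the scaling factor \<open>r\<close> is 1 or
  -1 as well.\<close>

lemma monic_factor_int:
  assumes "map_poly rat_of_int p = g * h" "monic p" "monic g"
  shows "\<exists>g'. g = map_poly rat_of_int g'"
proof -
  obtain r rg where rg: "rat_to_normalized_int_poly g = (r,rg)" by force
  from rat_to_int_factor_explicit[OF assms(1) rg] obtain q where "p = rg * smult (content p) q" by auto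
  then have "lead_coeff rg * lead_coeff (smult (content p) q) = 1" using assms(2) by (metis lead_coeff_mult)
  then have l: "lead_coeff rg = 1 \<or> lead_coeff rg = -1" using zmult_eq_1_iff by auto
  have g: "g = smult r (map_poly rat_of_int rg)" using rat_to_normalized_int_poly(1)[OF rg] .
  then have "r * of_int (lead_coeff rg) = 1" using assms(3) 
    by (metis lead_coeff_smult of_int_hom.hom_lead_coeff)
  then have "r = 1 \<or> r = -1" using l by auto
  then have "g = map_poly rat_of_int (if r = 1 then rg else - rg)" using g by (auto simp: hom_distribs)
  then show ?thesis by blast
qed

lemma irreducible_root_imp_linear:
  fixes q :: "'a::field poly"
  assumes "irreducible q" "poly q r = 0"
  shows "degree q = 1"
proof -
  from assms(2) obtain h where h: "q = [:-r, 1:] * h" by (auto simp: poly_eq_0_iff_dvd elim: dvdE)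
  moreover have "\<not> [:-r, 1:] dvd 1" by (auto simp: is_unit_iff_degree)
  ultimately have "h dvd 1" using assms(1) irreducibleD by blast
  then have "degree h = 0" "h \<noteq> 0" by (auto simp: is_unit_iff_degree)
  then show ?thesis unfolding h by (subst degree_mult_eq) auto
qed

lemma monic_int_quadratic_cases:
  fixes q :: "rat poly"
  assumes "irreducible q" "monic q" "degree q \<le> 2" "q = map_poly of_int q'"
  obtains (linear) c :: int where "q = [:of_int c, 1:]"
  | (quadratic) a b :: int where "q = [:of_int b, of_int a, 1:]"
proof -
  have coeff: "coeff q i = of_int (coeff q' i)" for i using assms(4) by (simp add: coeff_map_poly)
  have "degree q \<noteq> 0" using assms(1) by (auto simp: irreducible_def is_unit_iff_degree)
  with assms(3) consider "degree q = 1" | "degree q = 2" by linarith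
  then show thesis
  proof cases
    case 1
    have "q = [:of_int (coeff q' 0), 1:]"
    proof (rule poly_eqI)
      show "coeff q n = coeff [:of_int (coeff q' 0), 1:] n" for n
        using 1 assms(2) coeff[of 0] coeff_eq_0[of q n] by (auto simp: coeff_pCons split: nat.split)
    qed
    then show thesis by (rule linear)
  next
    case 2
    have "q = [:of_int (coeff q' 0), of_int (coeff q' 1), 1:]"
    proof (rule poly_eqI)
      show "coeff q n = coeff [:of_int (coeff q' 0), of_int (coeff q' 1), 1:] n" for n
        using 2 assms(2) coeff[of 0] coeff[of 1] coeff_eq_0[of q n]
        by (auto simp: coeff_pCons numeral_eq_Suc split: nat.split)
    qed
    then show thesis by (rule quadratic)
  qed
qed

text \<open>The bound on the roots confines the integer coefficients to a finite range, and
  irreducibility removes the candidates with an integer root.\<close>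

lemma elementary_factor_of_small_roots:
  fixes q :: "rat poly"
  assumes irr: "irreducible q" and q: "monic q" "degree q \<le> 2" "q = map_poly of_int q'"
    and roots: "\<And>z::complex. poly (map_poly of_rat q) z = 0 \<Longrightarrow> Im z = 0 \<and> \<bar>Re z\<bar> < 2"
  shows "q \<in> elementary_factors"
  using irr q
proof (cases rule: monic_int_quadratic_cases)
  case (linear c)
  have "poly (map_poly of_rat q) (- of_int c :: complex) = 0" by (simp add: linear)
  from roots[OF this] have "\<bar>c\<bar> < 2" by simp
  then have "c = -1 \<or> c = 0 \<or> c = 1" by linarith
  then show ?thesis by (auto simp: linear elementary_factors_def)
next
  case (quadratic a b)
  have poly: "poly (map_poly of_rat q) z = of_int b + z * (of_int a + z)" for z :: complex
    by (simp add: quadratic)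
  have disc: "4 * b \<le> a\<^sup>2"
  proof (rule ccontr)
    assume neg: "\<not> 4 * b \<le> a\<^sup>2"
    \<comment> \<open>A negative discriminant would produce the nonreal root \<open>z\<close>
      below.\<close>
    define d :: real where "d = of_int (4 * b - a\<^sup>2)"
    have d: "d > 0" using neg unfolding d_def of_int_0_less_iff by simp
    define z where "z = Complex (- of_int a / 2) (sqrt d / 2)"
    have "poly (map_poly of_rat q) z = 0"
      using d unfolding poly by (simp add: z_def complex_eq_iff field_simps power2_eq_square d_def)
    from roots[OF this] d show False by (simp add: z_def)
  qed
  define s where "s = sqrt (of_int (a\<^sup>2 - 4 * b))"
  have s2: "s\<^sup>2 = of_int (a\<^sup>2 - 4 * b)" and s0: "s \<ge> 0"
    using disc by (simp_all only: s_def real_sqrt_pow2_iff of_int_0_le_iff real_sqrt_ge_0_iff)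
  have root: "\<bar>x\<bar> < 2" if "of_int b + x * (of_int a + x) = 0" for x :: real
  proof -
    have "poly (map_poly of_rat q) (complex_of_real x) = of_real (of_int b + x * (of_int a + x))"
      unfolding poly by simp
    then have "poly (map_poly of_rat q) (complex_of_real x) = 0" using that by simp
    from roots[OF this] show ?thesis by simp
  qed
  have "of_int b + (- of_int a + s) / 2 * (of_int a + (- of_int a + s) / 2) = 0"
    "of_int b + (- of_int a - s) / 2 * (of_int a + (- of_int a - s) / 2) = 0"
    using s2 by (simp_all add: field_simps power2_eq_square)
  \<comment> \<open>The larger root lies below 2 and the smaller one above -2; together they bound
    \<open>s\<close> by \<open>4 - \<bar>a\<bar>\<close>.\<close>
  then have "(- of_int a + s) / 2 < 2" "- ((- of_int a - s) / 2) < 2"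
    using root abs_less_iff by blast+
  then have "s < 4 + of_int a" "s < 4 - of_int a" by (simp_all add: field_simps)
  then have "s < 4 - of_int \<bar>a\<bar>" by (simp add: abs_if)
  then have "s\<^sup>2 < (4 - of_int \<bar>a\<bar>)\<^sup>2" and a4: "real_of_int \<bar>a\<bar> < 4" using s0 by (auto intro: power_strict_mono)
  then have "real_of_int (a\<^sup>2 - 4 * b) < of_int ((4 - \<bar>a\<bar>)\<^sup>2)" unfolding s2 by simp
  then have *: "a\<^sup>2 - 4 * b < (4 - \<bar>a\<bar>)\<^sup>2" by (simp only: of_int_less_iff)
  \<comment> \<open>An integer root would make \<open>q\<close> linear; the values at 0, 1 and -1
    suffice for the finite search.\<close>
  have "poly q (of_int r) = of_int (b + r * (a + r))" for r by (simp add: quadratic)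
  moreover have "poly q r \<noteq> 0" for r using irreducible_root_imp_linear[OF irr] by (auto simp: quadratic)
  ultimately have "rat_of_int (b + r * (a + r)) \<noteq> 0" for r by metis
  then have "b + r * (a + r) \<noteq> 0" for r unfolding of_int_eq_0_iff .
  from this[of 0] this[of 1] this[of "-1"]
  have nz: "b \<noteq> 0" "b + a + 1 \<noteq> 0" "b - a + 1 \<noteq> 0" by simp_all
  have "\<bar>a\<bar> < 4" using a4 by linarith
  then have "a = -3 \<or> a = -2 \<or> a = -1 \<or> a = 0 \<or> a = 1 \<or> a = 2 \<or> a = 3" by linarith
  \<comment> \<open>For \<open>\<bar>a\<bar> = 2\<close> the bounds leave only \<open>b = 1\<close>,
    which has the root 1 or -1; for \<open>\<bar>a\<bar> = 3\<close> they leave nothing.\<close>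
  then have "(a = 0 \<and> (b = -2 \<or> b = -3)) \<or> ((a = 1 \<or> a = -1) \<and> b = -1)"
    using * disc nz by (elim disjE) (simp_all, presburger+)
  then show ?thesis by (auto simp: quadratic elementary_factors_def)
qed

section \<open>Rational polynomials and their real and complex roots\<close>

interpretation of_rat_poly_hom: map_poly_comm_ring_hom "of_rat :: rat \<Rightarrow> 'a::field_char_0" ..

lemma exists_irreducible_factor_with_root:
  fixes f :: "rat poly" and z :: complex
  assumes "f \<noteq> 0" "poly (map_poly of_rat f) z = 0"
  shows "\<exists>q. irreducible q \<and> monic q \<and> q dvd f \<and> poly (map_poly of_rat q) z = 0"
  using assms
proof (induction "degree f" arbitrary: f rule: less_induct)
  case less
  have "degree f > 0"
  proof (rule ccontr)
    assume "\<not> degree f > 0"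
    then obtain c where "f = [:c:]" by (auto elim: degree_eq_zeroE)
    with less.prems show False by simp
  qed
  then obtain q r where q: "irreducible q" "f = q * r" "monic q" using irreducible_monic_factor by blast
  show ?case
  proof (cases "poly (map_poly of_rat q) z = 0")
    case False
    have "degree q \<noteq> 0" using q(1) by (auto simp: irreducible_def is_unit_iff_degree)
    then have "degree r < degree f" using less.prems(1) q(2) by (auto simp: degree_mult_eq)
    moreover have "poly (map_poly of_rat r) z = 0" "r \<noteq> 0"
      using less.prems q(2) False by (auto simp: of_rat_poly_hom.hom_mult)
    ultimately obtain p where "irreducible p \<and> monic p \<and> p dvd r \<and> poly (map_poly of_rat p) z = 0"
      using less.hyps[of r] by blast
    then show ?thesis using q(2) by (metis dvd_mult)
  qed (use q in auto)
qed

lemma poly_of_rat_star_val: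
  "poly (map_poly of_rat (star_val ns [:0, 1:])) z = star_val ns (z :: 'a::field_char_0)"
proof -
  have "map_poly of_rat (star_val ns [:0, 1:]) = (star_val ns (map_poly of_rat [:0, 1:]) :: 'a poly)"
    by (rule of_rat_poly_hom.hom_star_val)
  then show ?thesis by (simp add: poly_star_val)
qed

lemma star_val_of_int_poly:
  "star_val ns [:0, 1:] = (map_poly of_int (star_val ns [:0, 1:]) :: rat poly)"
proof -
  have "map_poly of_int (star_val ns [:0, 1:]) = (star_val ns (map_poly of_int [:0, 1:]) :: rat poly)"
    by (rule of_int_poly_hom.hom_star_val)
  then show ?thesis by simp
qed

text \<open>By the parity rule the polynomial is even or odd, so \<open>flip\<close> changes it at
  most by a sign, and being monic excludes the minus sign.\<close>

lemma flip_star_val: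
  assumes "monic (star_val ns [:0, 1:] :: 'a::{idom,ring_char_0} poly)"
  shows "flip (star_val ns [:0, 1:]) = (star_val ns [:0, 1:] :: 'a poly)"
proof -
  let ?f = "star_val ns [:0, 1:] :: 'a poly"
  have "?f \<circ>\<^sub>p [:0, -1:] = star_val ns ([:0, 1:] \<circ>\<^sub>p [:0, -1:])"
    by (rule pcompose_hom.hom_star_val)
  also have "[:0, 1:] \<circ>\<^sub>p [:0, -1:] = - [:0, 1 :: 'a:]"
    by (simp add: pcompose_pCons one_pCons del: pCons_one)
  finally have "?f \<circ>\<^sub>p [:0, -1:] = ?f \<or> ?f \<circ>\<^sub>p [:0, -1:] = - ?f"
    unfolding star_val_minus by (cases "even (sum_list ns)") simp_all
  then have "flip ?f = ?f \<or> flip ?f = - ?f"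
    unfolding flip_def by (cases "even (degree ?f)") auto
  moreover have "flip ?f \<noteq> - ?f"
  proof
    assume "flip ?f = - ?f"
    with monic_flip[OF assms] assms have "- 1 = (1 :: 'a)" by simp
    then show False by simp
  qed
  ultimately show ?thesis by blast
qed

text \<open>A common root of \<open>Q\<close> and \<open>g\<close> would let the quotient
  \<open>h\<close> by \<open>x - y\<close> vanish at \<open>y\<close>. Yet the growth bound makes
  \<open>h\<close> at least 1 to the right of \<open>y\<close>, hence by continuity also at
  \<open>y\<close>.\<close>

lemma star_val_simple_root:
  fixes y :: real
  assumes y: "2 \<le> y" "star_val ns y = 0"
    and f: "star_val ns [:0, 1:] = Q * g" and Q: "poly Q y = 0"
  shows "poly g y \<noteq> 0"
proof
  assume "poly g y = 0"
  with Q obtain Q' g' where Q': "Q = [:-y, 1:] * Q'" and g': "g = [:-y, 1:] * g'"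
    by (auto simp: poly_eq_0_iff_dvd elim!: dvdE)
  define h where "h = [:-y, 1:] * (Q' * g')"
  have "poly h x \<ge> 1" if "x > y" for x
  proof -
    have "star_val ns x = poly (Q * g) x" using poly_star_val[of ns "[:0, 1:]" x] f by simp
    also have "\<dots> = (x - y) * poly h x" by (simp add: Q' g' h_def algebra_simps)
    finally have "(x - y) * 1 \<le> (x - y) * poly h x" using star_val_growth[OF y(1) _ y(2), of x] that by simp
    then show ?thesis using that by (simp only: mult_le_cancel_left_pos diff_gt_0_iff_gt)
  qed
  then have "eventually (\<lambda>x. 1 \<le> poly h x) (at_right y)"
    by (auto simp: eventually_at_right_field intro: exI[of _ "y + 1"])
  moreover have "(poly h \<longlongrightarrow> poly h y) (at_right y)"
    by (intro isCont_tendsto_compose[OF poly_isCont]) (rule tendsto_ident_at)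
  ultimately have "1 \<le> poly h y" by (intro tendsto_lowerbound) auto
  then show False by (simp add: h_def)
qed

lemma map_poly_of_rat_of_real:
  "poly (map_poly of_rat p) (complex_of_real x) = of_real (poly (map_poly of_rat p) x)"
proof -
  have "of_rat a = complex_of_real (of_rat a)" for a by (cases a) (simp add: of_rat_rat)
  then show ?thesis by (induction p) (simp_all add: map_poly_pCons)
qed

lemma star_val_of_real: "star_val ns (complex_of_real x) = of_real (star_val ns x)"
  by (rule of_real_hom.hom_star_val[symmetric])

section \<open>Factorization when irreducible factors have degree at most two\<close>

context
  fixes ns :: "nat list" and f :: "rat poly"
  defines "f \<equiv> star_val ns [:0, 1:]"
  assumes monic_int: "monic (star_val ns [:0, 1:] :: int poly)"
    and quadratic: "\<And>p. irreducible p \<Longrightarrow> p dvd f \<Longrightarrow> degree p \<le> 2"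
begin

lemma monic_f: "monic f"
proof -
  have "f = map_poly of_int (star_val ns [:0, 1:])" unfolding f_def by (rule star_val_of_int_poly)
  then have "lead_coeff f = of_int (lead_coeff (star_val ns [:0, 1:]))"
    by (simp only: of_int_hom.hom_lead_coeff)
  then show ?thesis unfolding monic_int by simp
qed

lemma flip_f: "flip f = f"
  using monic_f unfolding f_def by (rule flip_star_val)

lemma poly_f: "poly (map_poly of_rat f) z = star_val ns (z :: 'a::field_char_0)"
  unfolding f_def by (rule poly_of_rat_star_val)

lemma poly_dvd_f:
  assumes "q dvd f" "poly (map_poly of_rat q) (z :: 'a::field_char_0) = 0"
  shows "star_val ns z = 0"
  using assms unfolding poly_f[symmetric] by (auto simp: of_rat_poly_hom.hom_mult elim!: dvdE)

lemma factor_int: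
  assumes "q dvd f" "monic q"
  shows "\<exists>q'. q = map_poly of_int q'"
proof -
  from assms(1) obtain h where "map_poly of_int (star_val ns [:0, 1:]) = q * h"
    unfolding f_def by (subst (asm) star_val_of_int_poly) (elim dvdE)
  then show ?thesis using monic_int assms(2) by (rule monic_factor_int)
qed

text \<open>A non-elementary factor has a root that is nonreal or of absolute value at least 2.
  Real-rootedness leaves the second case, and symmetry makes the absolute value a root too.\<close>

lemma large_root:
  assumes q: "irreducible q" "monic q" "q dvd f" "q \<notin> elementary_factors"
  shows "\<exists>z::complex. poly (map_poly of_rat q) z = 0 \<and> Im z = 0 \<and> \<bar>Re z\<bar> \<ge> 2 \<and> star_val ns \<bar>Re z\<bar> = 0"
proof -
  from factor_int[OF q(3,2)] obtain q' where "q = map_poly of_int q'" by blast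
  with elementary_factor_of_small_roots[OF q(1,2) quadratic[OF q(1,3)]] q(4)
  obtain z :: complex where z: "poly (map_poly of_rat q) z = 0" "Im z = 0 \<longrightarrow> \<bar>Re z\<bar> \<ge> 2" by force
  have fz: "star_val ns z = 0" by (rule poly_dvd_f[OF q(3) z(1)])
  then have Im: "Im z = 0" by (rule star_val_real_rooted)
  then have "z = complex_of_real (Re z)" by (simp add: complex_eq_iff)
  then have "star_val ns (Re z) = 0" using fz star_val_of_real[of ns "Re z"] by simp
  then have "star_val ns \<bar>Re z\<bar> = 0" by (simp add: abs_if star_val_minus)
  then show ?thesis using z Im by blast
qed

text \<open>A non-elementary factor of the cofactor \<open>g\<close> would have the root
  \<open>y\<close> or \<open>-y\<close>, since \<open>y\<close> is the only root that is at least 2.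
  By symmetry \<open>g\<close> would vanish at \<open>y\<close>, against simplicity.\<close>

lemma f_eq_elementary_product:
  fixes y :: real
  assumes y: "2 \<le> y" "star_val ns y = 0"
    and Q: "Q dvd f" "monic Q" "flip Q = Q" "poly (map_poly of_rat Q) y = 0"
  shows "\<exists>t1 t2 t3 t4 t5. f = elementary_product t1 t2 t3 t4 t5 * Q"
proof -
  from Q(1) obtain g where g: "f = Q * g" by (elim dvdE)
  have f0: "f \<noteq> 0" using monic_f by auto
  have "monic g" using monic_f Q(2) unfolding g by (metis lead_coeff_mult mult_1)
  have flip_g: "flip g = g" using flip_cancel[of Q g] flip_f Q(3) f0 by (simp add: g)
  have "(map_poly of_rat f :: real poly) = star_val ns [:0, 1:]"
  proof -
    have "map_poly of_rat f = (star_val ns (map_poly of_rat [:0, 1:]) :: real poly)"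
      unfolding f_def by (rule of_rat_poly_hom.hom_star_val)
    then show ?thesis by simp
  qed
  then have "star_val ns [:0, 1:] = map_poly of_rat Q * (map_poly of_rat g :: real poly)"
    by (simp add: g of_rat_poly_hom.hom_mult)
  from star_val_simple_root[OF y this Q(4)] have gy: "poly (map_poly of_rat g) y \<noteq> 0" .
  have "q \<in> elementary_factors" if q: "irreducible q" "monic q" "q dvd g" for q
  proof (rule ccontr)
    assume nq: "q \<notin> elementary_factors"
    have "q dvd f" using q(3) by (simp add: g)
    from large_root[OF q(1,2) this nq] obtain z :: complex where z: "poly (map_poly of_rat q) z = 0"
      "Im z = 0" "\<bar>Re z\<bar> \<ge> 2" "star_val ns \<bar>Re z\<bar> = 0" by blast
    have "\<bar>Re z\<bar> = y" using star_val_root_ge_2_unique[OF z(3) y(1) z(4) y(2)] .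
    then have "z = of_real y \<or> z = - of_real y" using z(2) by (auto simp: complex_eq_iff abs_if split: if_splits)
    moreover have gz: "poly (map_poly of_rat g) z = 0" using z(1) q(3) by (auto simp: of_rat_poly_hom.hom_mult elim!: dvdE)
    moreover have "poly (map_poly of_rat g) (- z) = 0"
    proof -
      \<comment> \<open>Invariance under \<open>flip\<close> means that \<open>g\<close> is even or
        odd, so its roots come in pairs \<open>z\<close> and \<open>-z\<close>.\<close>
      have "g \<circ>\<^sub>p [:0, -1:] = g \<or> g \<circ>\<^sub>p [:0, -1:] = - g"
        using flip_g unfolding flip_def by (cases "even (degree g)") (auto simp: minus_equation_iff)
      then have "map_poly of_rat (g \<circ>\<^sub>p [:0, -1:]) = (map_poly of_rat g :: complex poly) \<or>
          map_poly of_rat (g \<circ>\<^sub>p [:0, -1:]) = - (map_poly of_rat g :: complex poly)"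
        by (metis of_rat_poly_hom.hom_uminus)
      moreover have "map_poly of_rat [:0, -1:] = [:0, -1 :: complex:]"
        by (simp add: map_poly_pCons of_rat_minus)
      then have "map_poly of_rat (g \<circ>\<^sub>p [:0, -1:]) = map_poly of_rat g \<circ>\<^sub>p [:0, -1 :: complex:]"
        by (simp only: of_rat_hom.map_poly_pcompose)
      ultimately have "poly (map_poly of_rat g \<circ>\<^sub>p [:0, -1:]) z = 0" using gz by auto
      then show ?thesis by (simp add: poly_pcompose)
    qed
    ultimately have "poly (map_poly of_rat g) (complex_of_real y) = 0" by auto
    then show False using gy unfolding map_poly_of_rat_of_real by simp
  qed
  with elementary_product_exists[OF \<open>monic g\<close> flip_g] show ?thesis
    unfolding g by (metis mult.commute)
qed

text \<open>The factor belonging to \<open>x\<close> is not elementary, which yields a root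
  \<open>y \<ge> 2\<close>. The irreducible factor \<open>q\<close> of \<open>y\<close> then
  decides: a linear or even \<open>q\<close> leads to x^2 - c, any other to
  \<open>q * flip q\<close>.\<close>

theorem star_val_quadratic_form:
  fixes x :: real
  assumes x: "x > sqrt 3" "star_val ns x = 0"
  shows "\<exists>y::real. 2 \<le> y \<and> star_val ns y = 0 \<and>
    ((\<exists>t1 t2 t3 t4 t5. \<exists>c::int. c \<ge> 4 \<and>
        f = elementary_product t1 t2 t3 t4 t5 * [:- of_int c, 0, 1:] \<and>
        poly [:- of_int c, 0, 1:] y = 0) \<or>
     (\<exists>t1 t2 t3 t4 t5. \<exists>a b::int. a > 0 \<and> a\<^sup>2 - 4 * b > 0 \<and> \<not> is_square (a\<^sup>2 - 4 * b) \<and>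
        f = elementary_product t1 t2 t3 t4 t5 * [:of_int b, - of_int a, 1:] * [:of_int b, of_int a, 1:] \<and>
        poly [:of_int b, - of_int a, 1:] y = 0))"
proof -
  have f0: "f \<noteq> 0" using monic_f by auto
  have root_f: "poly (map_poly of_rat f) (complex_of_real r) = 0" if "star_val ns r = 0" for r
    using that by (simp add: poly_f star_val_of_real)
  have "\<exists>y::real. 2 \<le> y \<and> star_val ns y = 0"
  proof -
    from exists_irreducible_factor_with_root[OF f0 root_f[OF x(2)]] obtain q where
      q: "irreducible q" "monic q" "q dvd f" and "poly (map_poly of_rat q) (complex_of_real x) = 0" by blast
    then have qx: "poly (map_poly of_rat q) x = 0" unfolding map_poly_of_rat_of_real by simp
    have "q \<notin> elementary_factors"
    proof
      assume "q \<in> elementary_factors"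
      \<comment> \<open>A rational lower bound for \<open>sqrt 3\<close> that is still above the
        golden ratio: 1.7 * 0.7 > 1 excludes the roots of x^2 - x - 1.\<close>
      have "17 / 10 < sqrt 3" by (rule real_less_rsqrt) (simp add: power2_eq_square)
      with x(1) have x17: "17 / 10 < x" by linarith
      have "sqrt 3 * sqrt 3 < x * x" using x(1) x17 by (intro mult_strict_mono) auto
      then have xx: "3 < x * x" by simp
      have "17 / 10 * (7 / 10) < x * (x - 1)" using x17 by (intro mult_strict_mono) auto
      then have "1 < x * x - x" by (simp add: algebra_simps)
      with x17 xx qx \<open>q \<in> elementary_factors\<close> show False
        unfolding elementary_factors_def by (auto simp: algebra_simps)
    qed
    from large_root[OF q this] show ?thesis by blast
  qed
  then obtain y :: real where y: "2 \<le> y" "star_val ns y = 0" by blast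
  from exists_irreducible_factor_with_root[OF f0 root_f[OF y(2)]] obtain q where
    q: "irreducible q" "monic q" "q dvd f" and "poly (map_poly of_rat q) (complex_of_real y) = 0" by blast
  then have qy: "poly (map_poly of_rat q) y = 0" unfolding map_poly_of_rat_of_real by simp
  from factor_int[OF q(3,2)] obtain q' where q': "q = map_poly of_int q'" by blast
  have yy: "4 \<le> y * y" using mult_mono[of 2 y 2 y] y(1) by simp
  have flip_q: "flip q dvd f" using flip_dvd[OF flip_f q(3) f0] .
  have pair: "q * flip q dvd f" if "flip q \<noteq> q"
    using irreducible_mult_dvd[OF q(1,2) monic_flip[OF q(2)] _ that q(3) flip_q] by simp
  have fixed: "flip (q * flip q) = q * flip q"
  proof -
    have "q \<noteq> 0" "flip q \<noteq> 0" using q(2) monic_flip[OF q(2)] by auto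
    then show ?thesis by (simp add: flip_mult mult.commute)
  qed
  have even_form: ?thesis if c: "[:- of_int c, 0, 1:] dvd f" "y * y = of_int c" for c :: int
  proof -
    have "\<exists>t1 t2 t3 t4 t5. f = elementary_product t1 t2 t3 t4 t5 * [:- of_int c, 0, 1:]"
      using c by (intro f_eq_elementary_product[OF y]) (simp_all add: flip_def pcompose_pCons map_poly_pCons of_rat_minus)
    moreover have "c \<ge> 4" using yy c(2) by linarith
    moreover have "poly [:- of_int c, 0, 1:] y = 0" using c(2) by simp
    ultimately show ?thesis using y by blast
  qed
  from q(1,2) quadratic[OF q(1,3)] q' show ?thesis
  proof (cases rule: monic_int_quadratic_cases)
    case (linear c)
    have yc: "y = - of_int c" using qy by (simp add: linear)
    have flip_eq: "flip q = [:- of_int c, 1:]" by (simp add: linear flip_def pcompose_pCons)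
    have "c \<noteq> 0" using yc y(1) by auto
    then have "flip q \<noteq> q" unfolding flip_eq by (simp add: linear)
    then have "q * flip q dvd f" by (rule pair)
    moreover have "q * flip q = [:- of_int (c\<^sup>2), 0, 1:]"
      unfolding flip_eq by (simp add: linear power2_eq_square one_pCons del: pCons_one)
    ultimately have "[:- of_int (c\<^sup>2), 0, 1:] dvd f" by simp
    moreover have "y * y = of_int (c\<^sup>2)" by (simp add: yc power2_eq_square)
    ultimately show ?thesis by (rule even_form)
  next
    case (quadratic a b)
    have qy': "of_int b + y * (of_int a + y) = 0" using qy by (simp add: quadratic)
    show ?thesis
    proof (cases "a = 0")
      case True
      then have "[:- of_int (- b), 0, 1:] dvd f" "y * y = of_int (- b)"
        using q(3) qy' by (simp_all add: quadratic)
      then show ?thesis by (rule even_form)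
    next
      case False
      have flip_eq: "flip q = [:of_int b, - of_int a, 1:]" by (simp add: quadratic flip_def pcompose_pCons)
      have "flip q \<noteq> q" using False unfolding flip_eq by (simp add: quadratic)
      then have dvd: "q * flip q dvd f" by (rule pair)
      have disc: "of_int (a\<^sup>2 - 4 * b) = (2 * y + of_int a)\<^sup>2"
        using qy' by (simp add: power2_eq_square algebra_simps)
      have not_square: "\<not> is_square (a\<^sup>2 - 4 * b)"
      proof
        assume "is_square (a\<^sup>2 - 4 * b)"
        \<comment> \<open>The quadratic formula would give a rational root of
          \<open>q\<close>.\<close>
        then obtain k where k: "a\<^sup>2 - 4 * b = k\<^sup>2" by (auto elim: is_nth_powerE)
        have "rat_of_int a * of_int a - 4 * of_int b = of_int k * of_int k"
          using arg_cong[OF k, of rat_of_int] by (simp add: power2_eq_square)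
        then have "poly q ((- of_int a + of_int k) / 2) = 0"
          by (simp add: quadratic field_simps)
        from irreducible_root_imp_linear[OF q(1) this] show False by (simp add: quadratic)
      qed
      have "of_int (a\<^sup>2 - 4 * b) \<ge> (0::real)" unfolding disc by simp
      then have "a\<^sup>2 - 4 * b \<ge> 0" by (simp only: of_int_0_le_iff)
      moreover have "a\<^sup>2 - 4 * b \<noteq> 0" using not_square by (metis is_nth_power_0 pos2)
      ultimately have disc_pos: "a\<^sup>2 - 4 * b > 0" by simp
      \<comment> \<open>The other root of \<open>q\<close>, by Vieta. It differs from
        \<open>y\<close> and \<open>-y\<close>, so uniqueness gives
        \<open>\<bar>m\<bar> < 2 \<le> y\<close>, and \<open>- a = m + y\<close> is
        positive.\<close>
      define m where "m = - of_int a - y"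
      have "poly (map_poly of_rat q) m = 0"
        using qy' by (simp add: quadratic m_def algebra_simps)
      then have m: "star_val ns m = 0" using poly_dvd_f[OF q(3)] by blast
      have "m \<noteq> y" 
      proof
        assume "m = y"
        then have "2 * y + of_int a = 0" by (simp add: m_def)
        then have "real_of_int (a\<^sup>2 - 4 * b) = 0" unfolding disc by simp
        with disc_pos show False by (simp only: of_int_eq_0_iff)
      qed
      moreover have "m \<noteq> - y" using False by (simp add: m_def)
      moreover have "star_val ns \<bar>m\<bar> = 0" using m by (simp add: abs_if star_val_minus)
      ultimately have "\<bar>m\<bar> \<noteq> y" "star_val ns \<bar>m\<bar> = 0" by (auto simp: abs_if)
      then have "\<bar>m\<bar> < 2" using star_val_root_ge_2_unique y by (metis linorder_not_le)
      then have "real_of_int a < 0" using y(1) by (simp add: m_def)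
      then have "- a > 0" by simp
      have "\<exists>t1 t2 t3 t4 t5. f = elementary_product t1 t2 t3 t4 t5 * (q * flip q)"
      proof (rule f_eq_elementary_product[OF y dvd _ fixed])
        show "monic (q * flip q)" using q(2) monic_flip[OF q(2)] by (metis lead_coeff_mult mult_1)
        show "poly (map_poly of_rat (q * flip q)) y = 0" using qy by (simp add: of_rat_poly_hom.hom_mult)
      qed
      then obtain t1 t2 t3 t4 t5 where "f = elementary_product t1 t2 t3 t4 t5 * q * flip q"
        unfolding mult.assoc[symmetric] by blast
      \<comment> \<open>Since \<open>q\<close> itself is x^2 + a x + b with negative
        \<open>a\<close>, the positive parameter of the claim is \<open>- a\<close>.\<close>
      then have "f = elementary_product t1 t2 t3 t4 t5 * [:of_int b, - of_int (- a), 1:] * [:of_int b, of_int (- a), 1:]"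
        by (simp only: flip_eq) (simp only: quadratic of_int_minus minus_minus)
      moreover have "poly [:of_int b, - of_int (- a), 1:] y = 0" using qy' by simp
      ultimately show ?thesis using y not_square disc_pos \<open>- a > 0\<close> power2_minus[of a] by metis
    qed
  qed
qed

end

subsection \<open>Starlike trees\<close>

lemma char_poly_adjacency_matrix:
  assumes "finite (verts G)" "distinct vs" "set vs = verts G"
  shows "char_poly (adjacency_matrix G :: 'c::comm_ring_1 mat) = adj_poly (dominates G) vs"
proof -
  have "\<exists>vs. distinct vs \<and> set vs = verts G" using finite_distinct_list[OF assms(1)] by auto
  then have vl: "distinct (vertex_list G) \<and> set (vertex_list G) = verts G"
    unfolding vertex_list_def by (rule someI_ex)
  have "char_poly (adjacency_matrix G :: 'c mat) = adj_poly (dominates G) (vertex_list G)"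
    by (simp add: adjacency_matrix_def adj_poly_def Let_def)
  also have "\<dots> = adj_poly (dominates G) vs"
    using assms vl by (intro adj_poly_permute) auto
  finally show ?thesis .
qed

lemma starlike_center_structure:
  assumes "graph G" "starlike_center G u"
  obtains ps where "star_structure (dominates G) u ps" "[] \<notin> set ps" "verts G = set (u # concat ps)"
proof -
  interpret graph G by fact
  from assms(2) obtain ps where ps: "[] \<notin> set ps" "distinct (concat ps)"
    "verts (del_vert u) = set (concat ps)" "arcs_ends (del_vert u) = (\<Union>p\<in>set ps. path_ends p)"
    "{v. u \<rightarrow>\<^bsub>G\<^esub> v} = hd ` set ps" and u: "u \<in> verts G"
    unfolding starlike_center_def by blast
  have verts: "verts G = set (u # concat ps)" "u \<notin> set (concat ps)"
    using ps(3) u by (auto simp: verts_del_vert)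
  have ends: "(x, y) \<in> arcs_ends (del_vert u) \<longleftrightarrow> x \<rightarrow>\<^bsub>G\<^esub> y" if "x \<noteq> u" "y \<noteq> u" for x y
    using that by (auto simp: arcs_ends_def arc_to_ends_def del_vert_def)
  have "star_structure (dominates G) u ps"
    unfolding star_structure_def
  proof (intro conjI ballI)
    show "distinct (u # concat ps)" using ps(2) verts(2) by simp
    show "\<not> u \<rightarrow>\<^bsub>G\<^esub> u" using no_loops by (auto simp: arcs_ends_def arc_to_ends_def)
    fix x assume x: "x \<in> set (concat ps)"
    have "u \<rightarrow>\<^bsub>G\<^esub> x \<longleftrightarrow> x \<in> hd ` set ps" unfolding ps(5)[symmetric] by simp
    then show "u \<rightarrow>\<^bsub>G\<^esub> x \<longleftrightarrow> (\<exists>p\<in>set ps. p \<noteq> [] \<and> x = hd p)" using ps(1) unfolding image_iff by metis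
    show "x \<rightarrow>\<^bsub>G\<^esub> u \<longleftrightarrow> u \<rightarrow>\<^bsub>G\<^esub> x" using arcs_ends_symmetric[OF sym_arcs] by blast
    fix y assume y: "y \<in> set (concat ps)"
    have "x \<noteq> u" "y \<noteq> u" using x y verts(2) by blast+
    from ends[OF this] show "x \<rightarrow>\<^bsub>G\<^esub> y \<longleftrightarrow> (\<exists>p\<in>set ps. (x, y) \<in> path_ends p)" unfolding ps(4) by blast
  qed
  with ps(1) verts(1) show thesis by (intro that)
qed

lemma char_poly_starlike:
  assumes "graph G" and st: "star_structure (dominates G) u ps" and "verts G = set (u # concat ps)"
  shows "char_poly (adjacency_matrix G :: 'c::comm_ring_1 mat) = star_val (map length ps) [:0, 1:]"
proof -
  have "char_poly (adjacency_matrix G :: 'c mat) = adj_poly (dominates G) (u # concat ps)"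
    using star_structureD(1)[OF st] assms(3) by (intro char_poly_adjacency_matrix) simp_all
  also have "\<dots> = star_val (map length ps) [:0, 1:]" by (rule adj_poly_star[OF st])
  finally show ?thesis .
qed

section \<open>Vertex degrees and the induced claw\<close>

lemma path_ends_neighbours:
  assumes "distinct p"
  shows "\<exists>s t. {y. (x, y) \<in> path_ends p} \<subseteq> {s, t}"
proof -
  have unique: "y = y'" if "distinct xs" "(x, y) \<in> set (zip xs ys)" "(x, y') \<in> set (zip xs ys)" for y y' xs ys
    using that by (auto simp: in_set_zip nth_eq_iff_index_eq)
  have "y = y'" if "(x, y) \<in> set (zip p (tl p))" "(x, y') \<in> set (zip p (tl p))" for y y'
    by (rule unique[OF assms that])
  moreover have "y = y'" if "(y, x) \<in> set (zip p (tl p))" "(y', x) \<in> set (zip p (tl p))" for y y'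
  proof -
    have swap: "(x, y) \<in> set (zip (tl p) p)" if "(y, x) \<in> set (zip p (tl p))" for y
      using that by (auto simp: in_set_zip)
    show ?thesis by (rule unique[OF distinct_tl[OF assms] that[THEN swap]])
  qed
  \<comment> \<open>On a path without repetition \<open>x\<close> has at most one successor
    \<open>s\<close> and at most one predecessor \<open>t\<close>.\<close>
  ultimately have "\<exists>s. \<forall>y. (x, y) \<in> set (zip p (tl p)) \<longrightarrow> y = s"
    "\<exists>t. \<forall>y. (y, x) \<in> set (zip p (tl p)) \<longrightarrow> y = t" by metis+
  then show ?thesis unfolding path_ends_def by blast
qed

text \<open>All neighbours of \<open>w\<close> lie on the path \<open>u # p\<close> formed by the
  center and the branch through \<open>w\<close>.\<close>

lemma star_structure_degree_le_2:
  assumes st: "star_structure E u ps" and w: "w \<in> set (concat ps)"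
  shows "\<exists>s t. {y \<in> set (u # concat ps). E w y} \<subseteq> {s, t}"
proof -
  note D = star_structureD[OF st]
  from w obtain p where p: "p \<in> set ps" "w \<in> set p" by auto
  have "distinct (u # p)" using D(1) p(1) by (auto simp: distinct_concat_iff)
  have other: "q = p" if "q \<in> set ps" "w \<in> set q" for q
    using D(1) p that by (fastforce simp: distinct_concat_iff)
  have "{y \<in> set (u # concat ps). E w y} \<subseteq> {y. (w, y) \<in> path_ends (u # p)}"
  proof safe
    fix y assume y: "y \<in> set (u # concat ps)" "E w y"
    show "(w, y) \<in> path_ends (u # p)"
    proof (cases "y = u")
      case True
      with y w D(4,5) obtain q where q: "q \<in> set ps" "q \<noteq> []" "w = hd q" by blast
      then have "q = p" using other by simp
      then show ?thesis using True q by (cases p) (auto simp: path_ends_Cons_Cons)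
    next
      case False
      with y w D(3) obtain q where q: "q \<in> set ps" "(w, y) \<in> path_ends q" by auto
      then have "q = p" using other path_ends_subset[of q] by blast
      then show ?thesis using q p(2) by (cases p) (auto simp: path_ends_Cons_Cons)
    qed
  qed
  with path_ends_neighbours[OF \<open>distinct (u # p)\<close>, of w] show ?thesis by (meson subset_trans)
qed

text \<open>Only the center can have three neighbours, so the claw is centered at \<open>u\<close>
  and its leaves are heads of branches. Three branches of length 1 would leave just four vertices,
  and the claw would be the whole graph.\<close>

lemma star_branches_of_proper_induced_K13:
  assumes st: "star_structure (dominates G) u ps" and verts: "verts G = set (u # concat ps)"
    and K: "has_proper_induced_K13 G"
  shows "length ps \<ge> 3" and "length ps \<ge> 4 \<or> (\<exists>p\<in>set ps. length p \<ge> 2)"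
proof -
  note D = star_structureD[OF st]
  from K obtain H where H: "induced_subgraph H G" "H \<noteq> G" "K\<^bsub>1,3\<^esub> H"
    unfolding has_proper_induced_K13_def by blast
  from H(3) obtain U V where UV: "verts H = U \<union> V" "U \<inter> V = {}" "card U = 1" "card V = 3"
    "arcs_ends H = U \<times> V \<union> V \<times> U"
    unfolding complete_bipartite_digraph_def by blast
  from UV(3) obtain w where w: "U = {w}" by (auto simp: card_1_singleton_iff)
  have sub: "verts H \<subseteq> verts G" "arcs H \<subseteq> arcs G" "tail H = tail G" "head H = head G"
    using H(1) by (auto simp: induced_subgraph_def subgraph_def compatible_def)
  have "arcs_ends H \<subseteq> arcs_ends G"
    using sub by (auto simp: arcs_ends_def arc_to_ends_def)
  then have nbrs: "V \<subseteq> {y \<in> set (u # concat ps). w \<rightarrow>\<^bsub>G\<^esub> y}"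
    using UV(1,5) w sub(1) verts by blast
  have finV: "finite V" using UV(4) by (intro card_ge_0_finite) simp
  have "w = u"
  proof (rule ccontr)
    assume "w \<noteq> u"
    then have "w \<in> set (concat ps)" using UV(1) w sub(1) verts by auto
    from star_structure_degree_le_2[OF st this] nbrs obtain s t where "V \<subseteq> {s, t}" by blast
    then have "card V \<le> card {s, t}" by (intro card_mono) auto
    also have "\<dots> \<le> 2" by (simp add: card_insert_if)
    finally show False using UV(4) by simp
  qed
  have "V \<subseteq> hd ` set ps"
  proof
    fix v assume v: "v \<in> V"
    then have "v \<in> set (concat ps)" using nbrs UV(2) w \<open>w = u\<close> by auto
    with D(4) nbrs v \<open>w = u\<close> show "v \<in> hd ` set ps" by blast
  qed
  then have "card V \<le> card (hd ` set ps)" by (intro card_mono) auto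
  also have "\<dots> \<le> length ps" using card_image_le[of "set ps" hd] card_length[of ps] by simp
  finally show len: "length ps \<ge> 3" using UV(4) by simp
  show "length ps \<ge> 4 \<or> (\<exists>p\<in>set ps. length p \<ge> 2)"
  proof (rule ccontr)
    assume "\<not> (length ps \<ge> 4 \<or> (\<exists>p\<in>set ps. length p \<ge> 2))"
    then have len3: "length ps = 3" and short: "\<And>p. p \<in> set ps \<Longrightarrow> length p \<le> 1" using len by fastforce+
    have "length (concat ps) \<le> (\<Sum>p\<leftarrow>ps. 1)"
      unfolding length_concat using short by (intro sum_list_mono) auto
    then have "length (u # concat ps) \<le> 4" using len3 by (simp add: sum_list_triv)
    then have "card (verts G) \<le> 4" unfolding verts using card_length[of "u # concat ps"] by linarith
    moreover have "card (verts H) = 4"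
      using UV finV w by (simp add: card_Un_disjoint)
    moreover have "finite (verts G)" unfolding verts by simp
    ultimately have eq: "verts H = verts G" using sub(1) by (metis card_seteq)
    \<comment> \<open>An induced subgraph on all vertices contains all arcs, as arcs end in
      vertices.\<close>
    have "wf_digraph G" using H(1) by (simp add: induced_subgraph_def subgraph_def)
    then have "arcs H = arcs G" using H(1) eq by (auto simp: induced_subgraph_def wf_digraph_def)
    with eq sub have "H = G" by simp
    with H(2) show False by simp
  qed
qed

text \<open>An eigenvalue below 2 is smaller than \<open>y\<close>, and one that is at least 2
  equals \<open>y\<close> by uniqueness.\<close>

lemma largest_eigenvalue_eq:
  assumes "char_poly (adjacency_matrix G :: real mat) = star_val ns [:0, 1:]"
    and y: "2 \<le> y" "star_val ns y = 0"
  shows "largest_eigenvalue G = y"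
proof -
  let ?A = "adjacency_matrix G :: real mat"
  have A: "?A \<in> carrier_mat (length (vertex_list G)) (length (vertex_list G))"
    by (simp add: adjacency_matrix_def Let_def)
  have ev: "eigenvalue ?A k \<longleftrightarrow> star_val ns k = 0" for k
    using eigenvalue_root_char_poly[OF A] by (simp add: assms(1) poly_star_val)
  have "char_poly ?A \<noteq> 0" using degree_monic_char_poly[OF A] by auto
  then have "finite {k. poly (char_poly ?A) k = 0}" by (rule poly_roots_finite)
  then have fin: "finite {k. eigenvalue ?A k}" by (simp add: eigenvalue_root_char_poly[OF A])
  show ?thesis unfolding largest_eigenvalue_def
  proof (rule Max_eqI[OF fin])
    show "y \<in> {k. eigenvalue ?A k}" using y(2) by (simp add: ev)
    fix k assume "k \<in> {k. eigenvalue ?A k}"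
    then have "star_val ns k = 0" by (simp add: ev)
    then show "k \<le> y" using star_val_root_ge_2_unique[of k y ns] y by (cases "k \<ge> 2") auto
  qed
qed

theorem theorem3p6:
  fixes T :: "('a, 'b) pre_digraph"
  assumes "starlike_tree T"
    and "quadratic_graph T"
    and "has_proper_induced_K13 T"
  shows
    "(\<exists>(t1::nat) (t2::nat) (t3::nat) (t4::nat) (t5::nat) (c::int).
        c \<ge> 4 \<and>
        graph_char_poly T =
          [:0, 1:] ^ t1 * [:-1, 0, 1:] ^ t2 * [:-2, 0, 1:] ^ t3 *
          ([:-1, -1, 1:] * [:-1, 1, 1:]) ^ t4 * [:-3, 0, 1:] ^ t5 *
          [:- of_int c, 0, 1:] \<and>
        poly [:- of_int c, 0, 1:] (largest_eigenvalue T) = 0)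
     \<or>
     (\<exists>(t1::nat) (t2::nat) (t3::nat) (t4::nat) (t5::nat) (a::int) (b::int).
        a > 0 \<and> a\<^sup>2 - 4 * b > 0 \<and> \<not> is_square (a\<^sup>2 - 4 * b) \<and>
        graph_char_poly T =
          [:0, 1:] ^ t1 * [:-1, 0, 1:] ^ t2 * [:-2, 0, 1:] ^ t3 *
          ([:-1, -1, 1:] * [:-1, 1, 1:]) ^ t4 * [:-3, 0, 1:] ^ t5 *
          [:of_int b, - of_int a, 1:] * [:of_int b, of_int a, 1:] \<and>
        poly [:of_int b, - of_int a, 1:] (largest_eigenvalue T) = 0)"
proof -
  from assms(1) obtain u where u: "starlike_center T u" by (auto simp: starlike_tree_def)
  from assms(2) have "graph T" by (simp add: quadratic_graph_def)
  from starlike_center_structure[OF this u] obtain ps where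
    st: "star_structure (dominates T) u ps" and ps: "[] \<notin> set ps" "verts T = set (u # concat ps)" .
  define ns where "ns = map length ps"
  \<comment> \<open>The integers give integral factors, the rationals the factorization, and the
    reals the largest eigenvalue.\<close>
  have char_poly: "char_poly (adjacency_matrix T :: int mat) = star_val ns [:0, 1:]"
    "graph_char_poly T = star_val ns [:0, 1:]"
    "char_poly (adjacency_matrix T :: real mat) = star_val ns [:0, 1:]"
    unfolding graph_char_poly_def ns_def by (rule char_poly_starlike[OF \<open>graph T\<close> st ps(2)])+
  have "(adjacency_matrix T :: int mat) \<in> carrier_mat (length (vertex_list T)) (length (vertex_list T))"
    by (simp add: adjacency_matrix_def Let_def)
  from degree_monic_char_poly[OF this] have monic: "monic (star_val ns [:0, 1:] :: int poly)"
    unfolding char_poly(1)[symmetric] by simp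
  have quadratic: "degree p \<le> 2" if "irreducible p" "p dvd star_val ns [:0, 1:]" for p :: "rat poly"
    using assms(2) that unfolding quadratic_graph_def char_poly(2) by blast
  have "length ns \<ge> 3" "length ns \<ge> 4 \<or> (\<exists>n\<in>set ns. n \<ge> 2)"
    using star_branches_of_proper_induced_K13[OF st ps(2) assms(3)] by (simp_all add: ns_def)
  moreover have "0 \<notin> set ns" using ps(1) by (auto simp: ns_def)
  ultimately obtain x :: real where x: "x > sqrt 3" "star_val ns x = 0"
    using star_val_root_gt_sqrt_3 by blast
  from star_val_quadratic_form[OF monic quadratic x] obtain y :: real where
    y: "2 \<le> y" "star_val ns y = 0" and form:
    "(\<exists>t1 t2 t3 t4 t5. \<exists>c::int. c \<ge> 4 \<and>
        graph_char_poly T = elementary_product t1 t2 t3 t4 t5 * [:- of_int c, 0, 1:] \<and>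
        poly [:- of_int c, 0, 1:] y = 0) \<or>
     (\<exists>t1 t2 t3 t4 t5. \<exists>a b::int. a > 0 \<and> a\<^sup>2 - 4 * b > 0 \<and> \<not> is_square (a\<^sup>2 - 4 * b) \<and>
        graph_char_poly T = elementary_product t1 t2 t3 t4 t5 * [:of_int b, - of_int a, 1:] * [:of_int b, of_int a, 1:] \<and>
        poly [:of_int b, - of_int a, 1:] y = 0)"
    unfolding char_poly(2) by blast
  have "largest_eigenvalue T = y" by (rule largest_eigenvalue_eq[OF char_poly(3) y])
  with form show ?thesis unfolding elementary_product_def by (simp only:)
qed

end
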